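(* The following hold. (1) For every integer $m\ge 3$, $R_3(x-y=(m-2)z)=m^3-m^2-m-1$. (2) For every integer $a\ge 3$, $R_3(a(x-y)=(a-1)z)=a^3+(a-1)^2$. (3) For all integers $a,b$ with $b\ge 1$, $a\ge b+2$ and $\gcd(a,b)=1$, $R_3(a(x-y)=bz)=a^3$.
   Context: For a linear equation $\mathcal{E}$ in variables $x_1,\dots,x_m$ and a positive integer $k$, the $k$-color Rado number $R_k(\mathcal{E})$ is the smallest positive integer $n$ such that every coloring of $[n]=\{1,\dots,n\}$ with $k$ colors admits a monochromatic solution to $\mathcal{E}$ (i.e. positive integers $x_1,\dots,x_m\in[n]$, all of the same color, satisfying $\mathcal{E}$); if no such $n$ exists (equivalently, some $k$-coloring of $\mathbb{N}$ has no monochromatic solution), $R_k(\mathcal{E})=\infty$. *)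

theory Defs
  imports Main "HOL-Library.Extended_Nat"
begin

text \<open>
  The pair \<open>([c\<^sub>1, \<dots>, c\<^sub>m], d)\<close> stands for the linear equation
  \<open>c\<^sub>1 * x\<^sub>1 + \<dots> + c\<^sub>m * x\<^sub>m = d\<close> in \<open>m\<close> variables.
\<close>
type_synonym linear_equation = "int list \<times> int"

definition satisfies :: "nat list \<Rightarrow> linear_equation \<Rightarrow> bool" where
  "satisfies xs E \<longleftrightarrow>
     length xs = length (fst E) \<and>
     (\<Sum>i<length (fst E). fst E ! i * int (xs ! i)) = snd E"

text \<open>The values of the variables need not be distinct.\<close>
definition has_mono_solution :: "linear_equation \<Rightarrow> nat \<Rightarrow> (nat \<Rightarrow> nat) \<Rightarrow> bool" where
  "has_mono_solution E n c \<longleftrightarrow>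
     (\<exists>xs. set xs \<subseteq> {1..n} \<and> satisfies xs E \<and> (\<exists>j. \<forall>x\<in>set xs. c x = j))"

text \<open>In \<^typ>\<open>enat\<close>, the infimum of the empty set is \<open>\<infinity>\<close>.\<close>
definition rado_number :: "nat \<Rightarrow> linear_equation \<Rightarrow> enat" where
  "rado_number k E =
     Inf (enat ` {n. n \<ge> 1 \<and> (\<forall>c. c ` {1..n} \<subseteq> {..<k} \<longrightarrow> has_mono_solution E n c)})"

text \<open>The equation \<open>a * (x - y) = b * z\<close> in the variables \<open>x, y, z\<close>.\<close>
definition diff_eq :: "int \<Rightarrow> int \<Rightarrow> linear_equation" where
  "diff_eq a b = ([a, - a, - b], 0)"

lemma satisfies_diff_eq:
  "satisfies [x, y, z] (diff_eq a b) \<longleftrightarrow> a * (int x - int y) = b * int z"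
  by (simp add: satisfies_def diff_eq_def lessThan_Suc algebra_simps)

end

theory Submission
  imports Defs
begin

text \<open>
  Lower bounds: for coprime \<open>a\<close> and \<open>b\<close> colour by the \<open>a\<close>-adic valuation; for \<open>b = a - 1\<close> modify
  this colouring near both ends of the interval; for \<open>x - y = t * z\<close> use the recursive block
  colouring known from Schur numbers.

  Upper bounds: a suitable finite set of points, polynomial in the parameters, admits no
  3-colouring because of finitely many solutions among these points.  This suffices directly for
  \<open>a = 1\<close> and for \<open>b = a - 1\<close>.  For \<open>a \<ge> b + 2\<close> it is used to show that a colouring of
  \<open>{1..a\<^sup>3}\<close> would have to be constant on the multiples of \<open>a\<^sup>2\<close>, by induction on \<open>j\<close> in
  \<open>j * a\<^sup>2\<close>; but \<open>x = a\<^sup>3\<close>, \<open>y = a\<^sup>3 - a\<^sup>2 * b\<close>, \<open>z = a\<^sup>3\<close> is a solution.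
\<close>

section \<open>Rado numbers and colourings of integer intervals\<close>

text \<open>Every triple used in a refutation solves the equation identically in the parameters, so
  one propositional contradiction serves infinitely many equations. The actual parameters matter
  only for the claim that the points lie in the interval, and this is where the exact length enters.
  For \<open>a \<ge> b + 2\<close> the upper bound turns the valuation colouring around: there the
  multiples of \<open>a ^ 2\<close> below \<open>a ^ 3\<close> form one class, and such uniformity
  is shown to be forced on every colouring. As the number of these multiples grows with
  \<open>a\<close>, the factor \<open>j\<close> becomes a third parameter of the points. The case
  \<open>b = a - 1\<close> must stay apart: some points of the inductive step then exceed
  \<open>a ^ 3\<close>, and the value really is larger, because the class of the multiples of
  \<open>a ^ 2\<close> can also absorb non-multiples of \<open>a\<close> near both ends. In every
  refutation two points known to have different colours lend their colours as names; this breaks the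
  symmetry between the colours.\<close>

definition mono_free :: "int \<Rightarrow> int \<Rightarrow> int \<Rightarrow> (int \<Rightarrow> nat) \<Rightarrow> bool" where
  "mono_free a b N c \<longleftrightarrow>
     (\<forall>x\<in>{1..N}. c x < 3) \<and>
     (\<forall>x\<in>{1..N}. \<forall>y\<in>{1..N}. \<forall>z\<in>{1..N}.
        a * (x - y) = b * z \<longrightarrow> \<not> (c x = c y \<and> c y = c z))"

lemma mono_freeD:
  assumes "mono_free a b N c" and "x \<in> {1..N}" "y \<in> {1..N}" "z \<in> {1..N}" and "a * (x - y) = b * z"
  shows "\<not> (c x = c y \<and> c y = c z)"
  using assms unfolding mono_free_def by blast

lemma has_mono_solution_diff_eq:
  "has_mono_solution (diff_eq a b) n c \<longleftrightarrow>
     (\<exists>x\<in>{1..n}. \<exists>y\<in>{1..n}. \<exists>z\<in>{1..n}.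
        a * (int x - int y) = b * int z \<and> c x = c y \<and> c y = c z)"
  (is "?L \<longleftrightarrow> ?R")
proof
  assume ?L
  then obtain xs j where xs: "set xs \<subseteq> {1..n}" "satisfies xs (diff_eq a b)" "\<forall>x\<in>set xs. c x = j"
    unfolding has_mono_solution_def by blast
  then have "length xs = 3"
    by (simp add: satisfies_def diff_eq_def)
  then obtain x y z where "xs = [x, y, z]"
    by (auto simp: length_Suc_conv eval_nat_numeral)
  with xs have "x \<in> {1..n}" "y \<in> {1..n}" "z \<in> {1..n}"
    "a * (int x - int y) = b * int z" "c x = c y" "c y = c z"
    by (simp_all add: satisfies_diff_eq)
  then show ?R
    by blast
next
  assume ?R
  then obtain x y z where "x \<in> {1..n}" "y \<in> {1..n}" "z \<in> {1..n}"
    "a * (int x - int y) = b * int z" "c x = c y" "c y = c z"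
    by blast
  then show ?L
    unfolding has_mono_solution_def
    by (intro exI[of _ "[x, y, z]"]) (auto simp: satisfies_diff_eq)
qed

text \<open>A good colouring of \<open>{1..N - 1}\<close> restricts to every shorter interval, so no
  \<open>n < N\<close> lies in the set whose infimum is taken. Colourings live on the integers
  because the end points and the points used later are polynomials with subtractions; composing with
  \<open>nat\<close> or \<open>int\<close> translates between the two settings.\<close>

lemma rado_number_eqI:
  assumes N: "N \<ge> 1"
    and upper: "\<And>c. \<not> mono_free a b N c"
    and lower: "mono_free a b (N - 1) c"
  shows "rado_number 3 (diff_eq a b) = enat (nat N)"
proof -
  let ?A = "{n. n \<ge> 1 \<and> (\<forall>c. c ` {1..n} \<subseteq> {..<3} \<longrightarrow> has_mono_solution (diff_eq a b) n c)}"
  have "nat N \<in> ?A"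
  proof (intro CollectI conjI allI impI)
    show "nat N \<ge> 1"
      using N by simp
    fix c :: "nat \<Rightarrow> nat"
    assume c: "c ` {1..nat N} \<subseteq> {..<3}"
    have "c (nat x) < 3" if "x \<in> {1..N}" for x
    proof -
      have "nat x \<in> {1..nat N}"
        using that by auto
      then show ?thesis
        using c by blast
    qed
    with upper[of "c \<circ> nat"] obtain x y z where
      "x \<in> {1..N}" "y \<in> {1..N}" "z \<in> {1..N}" "a * (x - y) = b * z"
      "c (nat x) = c (nat y)" "c (nat y) = c (nat z)"
      unfolding mono_free_def by auto
    then show "has_mono_solution (diff_eq a b) (nat N) c"
      unfolding has_mono_solution_diff_eq
      by (intro bexI[of _ "nat x"] bexI[of _ "nat y"] bexI[of _ "nat z"]) auto
  qed
  moreover have "nat N \<le> n" if "n \<in> ?A" for n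
  proof (rule ccontr)
    assume "\<not> nat N \<le> n"
    then have n: "int n \<le> N - 1"
      by linarith
    have "(\<lambda>x. c (int x)) ` {1..n} \<subseteq> {..<3}"
    proof (intro image_subsetI)
      fix x
      assume "x \<in> {1..n}"
      then have "int x \<in> {1..N - 1}"
        using n by auto
      then show "c (int x) \<in> {..<3}"
        using lower by (simp add: mono_free_def)
    qed
    moreover have "c' ` {1..n} \<subseteq> {..<3} \<longrightarrow> has_mono_solution (diff_eq a b) n c'" for c'
      using that by (elim CollectE conjE) (erule spec)
    ultimately have "has_mono_solution (diff_eq a b) n (\<lambda>x. c (int x))"
      by (rule rev_mp)
    then obtain x y z where xyz: "x \<in> {1..n}" "y \<in> {1..n}" "z \<in> {1..n}"
      and sol: "a * (int x - int y) = b * int z" "c (int x) = c (int y)" "c (int y) = c (int z)"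
      unfolding has_mono_solution_diff_eq by blast
    have "int w \<in> {1..N - 1}" if "w \<in> {1..n}" for w
      using that n by auto
    with xyz have "int x \<in> {1..N - 1}" "int y \<in> {1..N - 1}" "int z \<in> {1..N - 1}"
      by blast+
    then show False
      using lower sol unfolding mono_free_def by metis
  qed
  ultimately have "Inf (enat ` ?A) = enat (nat N)"
    by (intro antisym Inf_lower Inf_greatest) auto
  then show ?thesis
    by (simp add: rado_number_def)
qed

section \<open>Lower bounds\<close>

text \<open>Coprimality gives \<open>z = a * k\<close> and \<open>x - y = b * k\<close> in every
  solution. Hence if \<open>a ^ i\<close> divides \<open>x\<close> and \<open>y\<close>, then
  \<open>a ^ (i + 1)\<close> divides \<open>z\<close>: the third variable lies strictly above the
  common level of the other two. This excludes levels 0 and 1, and at the capped level 2 it would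
  make \<open>z\<close> a multiple of \<open>a ^ 3\<close>, which is too large.\<close>

lemma mono_free_valuation:
  fixes a b :: int
  assumes a: "a \<ge> 2" and coprime: "coprime a b"
  shows "mono_free a b (a ^ 3 - 1) (\<lambda>x. if a\<^sup>2 dvd x then 2 else if a dvd x then 1 else 0)"
    (is "mono_free a b _ ?c")
  unfolding mono_free_def
proof (intro conjI ballI impI)
  fix x y z
  assume z: "z \<in> {1..a ^ 3 - 1}" and eq: "a * (x - y) = b * z"
  have "a dvd b * z"
    by (simp flip: eq)
  then obtain k where k: "z = a * k"
    using coprime by (auto simp: coprime_dvd_mult_right_iff)
  then have diff: "x - y = b * k"
    using eq a by simp
  show "\<not> (?c x = ?c y \<and> ?c y = ?c z)"
  proof
    assume mono: "?c x = ?c y \<and> ?c y = ?c z"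
    have col: "?c w = 2 \<longleftrightarrow> a\<^sup>2 dvd w" "?c w = 1 \<longrightarrow> a dvd w" for w
      by simp_all
    have "?c z = 2 \<or> ?c z = 1"
      using k by simp
    then consider "a\<^sup>2 dvd x" "a\<^sup>2 dvd y" "a\<^sup>2 dvd z" | "a dvd x" "a dvd y" "\<not> a\<^sup>2 dvd z"
      using mono col by (metis numeral_eq_one_iff semiring_norm(85))
    then show False
    proof cases
      case 1
      then have "a\<^sup>2 dvd b * k"
        by (simp flip: diff)
      then have "a\<^sup>2 dvd k"
        using coprime by (simp add: coprime_dvd_mult_right_iff)
      then have "a ^ 3 dvd z"
        by (simp add: k power3_eq_cube power2_eq_square mult.assoc)
      then show False
        using z zdvd_imp_le[of "a ^ 3" z] by simp
    next
      case 2
      then have "a dvd b * k"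
        by (simp flip: diff)
      then have "a dvd k"
        using coprime by (simp add: coprime_dvd_mult_right_iff)
      then show False
        using 2 by (simp add: k power2_eq_square)
    qed
  qed
qed simp

text \<open>In the middle range the colours 2, 1, 0 mean valuation 0, 1, at least 2. In the end
  blocks \<open>x \<le> a ^ 2 - a\<close> and \<open>x > a ^ 3 - a\<close> the non-multiples of
  \<open>a\<close> take over the colour of the multiples of \<open>a ^ 2\<close>, and
  \<open>a ^ 3\<close> moves to colour 2. If \<open>z\<close> has colour 0, then
  \<open>x - y = (a ^ 2 - a) * i\<close> with \<open>1 \<le> i < a\<close>. Each end block has
  exactly \<open>a ^ 2 - a\<close> points, one too few to contain the smallest such difference; this
  is the origin of the length \<open>(a ^ 3 - a) + (a ^ 2 - a)\<close>.\<close>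

lemma mono_free_pred:
  fixes a :: int
  assumes a: "a \<ge> 3"
  shows "mono_free a (a - 1) (a ^ 3 + (a - 1)\<^sup>2 - 1)
    (\<lambda>x. if a\<^sup>2 - a < x \<and> x \<le> a ^ 3 - a
         then if a\<^sup>2 dvd x then 0 else if a dvd x then 1 else 2
         else if x = a ^ 3 then 2 else if a dvd x then 1 else 0)"
    (is "mono_free a _ ?N ?c")
  unfolding mono_free_def
proof (intro conjI ballI impI)
  fix x y z
  assume xyz: "x \<in> {1..?N}" "y \<in> {1..?N}" "z \<in> {1..?N}" and eq: "a * (x - y) = (a - 1) * z"
  have N: "?N = a ^ 3 + a\<^sup>2 - 2 * a"
    by (simp add: power2_eq_square algebra_simps)
  have sq: "a\<^sup>2 \<ge> 3 * a" and cube: "a ^ 3 \<ge> 3 * a\<^sup>2"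
    using a by (simp_all add: power2_eq_square power3_eq_cube mult_right_mono)
  have cop: "coprime a (a - 1)"
    by (metis coprime_commute coprime_diff_one_left)
  then have cop2: "coprime (a\<^sup>2) (a - 1)"
    by simp
  have "a dvd (a - 1) * z"
    by (simp flip: eq)
  then obtain k where k: "z = a * k"
    using cop by (auto simp: coprime_dvd_mult_right_iff)
  then have diff: "x - y = (a - 1) * k"
    using eq a by simp
  have kpos: "k \<ge> 1"
    using xyz a k by (simp add: zero_less_mult_iff int_one_le_iff_zero_less)
  have dvd_dif: "a dvd x - y \<longleftrightarrow> a dvd k"
    using cop by (simp add: diff coprime_dvd_mult_right_iff)
  have dvd_diff2: "a\<^sup>2 dvd x - y \<longleftrightarrow> a\<^sup>2 dvd k"
    using cop2 by (simp only: diff coprime_dvd_mult_right_iff)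
  have dvd_z: "a\<^sup>2 dvd z \<longleftrightarrow> a dvd k"
    using a by (simp add: k power2_eq_square)
  have dvd_cube: "a dvd a ^ 3" "a\<^sup>2 dvd a ^ 3"
    by (simp_all add: dvd_power_le le_imp_power_dvd)
  have power2_dvd: "a dvd w" if "a\<^sup>2 dvd w" for w
    using that by (metis dvd_mult_left power2_eq_square)
  \<comment> \<open>By \<open>low\<close> and \<open>high\<close>, the only multiple of
    \<open>a ^ 2\<close> in the end blocks is \<open>a ^ 3\<close>. So colour 1 still means
    valuation exactly one there, and the valuation argument covers all of colour 1.\<close>
  have low: "\<not> a\<^sup>2 dvd z" if "z \<le> a\<^sup>2 - a"
    using that xyz a zdvd_imp_le[of "a\<^sup>2" z] by auto
  have high: "\<not> a\<^sup>2 dvd z" if "a ^ 3 - a < z" "z \<noteq> a ^ 3"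
  proof
    assume "a\<^sup>2 dvd z"
    then have dvd: "a\<^sup>2 dvd z - a ^ 3"
      using dvd_cube by simp
    show False
    proof (cases "z > a ^ 3")
      case True
      then show False
        using dvd zdvd_imp_le[of "a\<^sup>2" "z - a ^ 3"] xyz a by (simp add: N)
    next
      case False
      then show False
        using dvd zdvd_imp_le[of "a\<^sup>2" "a ^ 3 - z"] that sq a by (simp add: dvd_diff_commute)
    qed
  qed
  have col1: "a dvd w \<and> (a\<^sup>2 - a < w \<and> w \<le> a ^ 3 - a \<longrightarrow> \<not> a\<^sup>2 dvd w) \<and> w \<noteq> a ^ 3" if "?c w = 1" for w
    using that a by (auto split: if_splits)
  have col2: "a\<^sup>2 - a < w \<and> w \<le> a ^ 3 - a \<and> \<not> a dvd w \<or> w = a ^ 3" if "?c w = 2" for w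
    using that by (simp split: if_splits)
  have col0: "a\<^sup>2 - a < w \<and> w \<le> a ^ 3 - a \<and> a\<^sup>2 dvd w \<or>
      (w \<le> a\<^sup>2 - a \<or> a ^ 3 - a < w) \<and> \<not> a dvd w" if "?c w = 0" for w
    using that by (simp split: if_splits add: not_less not_le)
  show "\<not> (?c x = ?c y \<and> ?c y = ?c z)"
  proof
    assume mono: "?c x = ?c y \<and> ?c y = ?c z"
    have az: "a dvd z"
      by (simp add: k)
    have "?c z = 1 \<or> ?c z = 2 \<or> ?c z = 0"
      by simp
    then consider "?c z = 1" | "?c z = 2" | "?c z = 0"
      by argo
    then show False
    proof cases
      case 1
      then have "\<not> a\<^sup>2 dvd z"
        using low high col1[OF 1] by (meson not_less)
      moreover have "a dvd x" "a dvd y"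
        using mono 1 col1[of x] col1[of y] by argo+
      ultimately show False
        using dvd_dif dvd_z by auto
    next
      case 2
      then have z: "z = a ^ 3"
        using az col2 by blast
      then have "k = a\<^sup>2"
        using k a by (simp add: power2_eq_square power3_eq_cube)
      then have d: "x - y = a ^ 3 - a\<^sup>2"
        by (simp add: diff power2_eq_square power3_eq_cube algebra_simps)
      \<comment> \<open>From \<open>y > a ^ 2 - a\<close> the difference
        \<open>a ^ 3 - a ^ 2\<close> carries \<open>x\<close> beyond \<open>a ^ 3 - a\<close>. Only
        \<open>x = a ^ 3\<close> is left, hence \<open>y = a ^ 2\<close>, which has colour
        0.\<close>
      have "x \<le> a ^ 3 - a \<or> x = a ^ 3"
        using mono 2 col2[of x] by argo
      moreover have "a\<^sup>2 - a < y" "y \<noteq> a\<^sup>2"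
      proof -
        have y: "a\<^sup>2 - a < y \<and> y \<le> a ^ 3 - a \<and> \<not> a dvd y \<or> y = a ^ 3"
          using mono 2 col2[of y] by argo
        show "a\<^sup>2 - a < y"
          using y sq cube a by linarith
        show "y \<noteq> a\<^sup>2"
          using y sq cube a by (auto simp: power2_eq_square)
      qed
      ultimately show False
        using d by linarith
    next
      case 3
      then have zm: "a\<^sup>2 dvd z" "a\<^sup>2 - a < z" "z \<le> a ^ 3 - a"
        using az col0[OF 3] by blast+
      then obtain i where i: "k = a * i"
        using dvd_z by auto
      have zi: "z = a\<^sup>2 * i"
        by (simp add: k i power2_eq_square)
      have "i \<ge> 1"
        using kpos a i by (simp add: zero_less_mult_iff int_one_le_iff_zero_less)
      moreover have "i < a"
      proof (rule ccontr)
        assume "\<not> i < a"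
        then have "a\<^sup>2 * a \<le> a\<^sup>2 * i"
          by (intro mult_left_mono) auto
        moreover have "a\<^sup>2 * a = a ^ 3"
          by (simp add: power2_eq_square power3_eq_cube)
        ultimately show False
          using zm a zi by linarith
      qed
      ultimately have "\<not> a dvd i"
        using zdvd_imp_le[of a i] by auto
      then have nd: "\<not> a\<^sup>2 dvd x - y"
        using a unfolding dvd_diff2 i by (simp add: power2_eq_square)
      have d: "x - y = a\<^sup>2 * i - a * i"
        by (simp add: diff i power2_eq_square algebra_simps)
      \<comment> \<open>Two multiples of \<open>a\<close> with colour 0 would be multiples of
        \<open>a ^ 2\<close>, against \<open>nd\<close>. So neither is a multiple of
        \<open>a\<close>, and both lie in the end blocks.\<close>
      have "a dvd x \<longleftrightarrow> a dvd y"
        using dvd_dif i by (metis diff_add_cancel dvd_add_right_iff dvd_triv_left)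
      moreover have c: "?c x = 0" "?c y = 0"
        using mono 3 by argo+
      note cols = col0[OF c(1)] col0[OF c(2)]
      ultimately have "\<not> a dvd x" "\<not> a dvd y"
        using cols nd dvd_diff[of "a\<^sup>2" x y] by blast+
      then have out: "x \<le> a\<^sup>2 - a \<or> a ^ 3 - a < x" "y \<le> a\<^sup>2 - a \<or> a ^ 3 - a < y"
        using cols power2_dvd by blast+
      \<comment> \<open>The value at \<open>i = 1\<close>; two points of the same end block differ
        by at most \<open>a ^ 2 - a - 1\<close>.\<close>
      have lower: "a\<^sup>2 * i - a * i \<ge> a\<^sup>2 - a"
      proof -
        have "(a\<^sup>2 - a) * 1 \<le> (a\<^sup>2 - a) * i"
          using \<open>i \<ge> 1\<close> sq a by (intro mult_left_mono) auto
        then show ?thesis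
          by (simp add: algebra_simps)
      qed
      \<comment> \<open>The value at \<open>i = a - 1\<close>; points of different end blocks differ
        by at least \<open>a ^ 3 - a ^ 2 + 1\<close>, which is more.\<close>
      have upper: "a\<^sup>2 * i - a * i \<le> a ^ 3 - 2 * a\<^sup>2 + a"
      proof -
        have "(a\<^sup>2 - a) * i \<le> (a\<^sup>2 - a) * (a - 1)"
          using \<open>i < a\<close> sq a by (intro mult_left_mono) auto
        then show ?thesis
          by (simp add: algebra_simps power2_eq_square power3_eq_cube)
      qed
      have "1 \<le> x" "x \<le> a ^ 3 + a\<^sup>2 - 2 * a" "1 \<le> y" "y \<le> a ^ 3 + a\<^sup>2 - 2 * a"
        using xyz unfolding N by auto
      then show False
        using out lower upper d sq a by linarith
    qed
  qed
qed simp

text \<open>Given a good colouring of \<open>{1..L}\<close>, a new colour fits on the points from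
  \<open>L + 1\<close> to \<open>(t + 1) * (L + 1) - 1\<close>, since the least \<open>x\<close> it
  can produce is \<open>(L + 1) + t * (L + 1)\<close>; a copy of the colouring of
  \<open>{1..L}\<close> can follow. Starting with one colour and \<open>L = t\<close>, this yields
  \<open>L = t ^ 2 + 3 * t\<close> and then the present length.
  \<open>M = (t + 1) * (t ^ 2 + 3 * t + 1)\<close> is the first point of the last copy, and
  \<open>q\<close> is the position relative to the copy. For \<open>t = 1\<close> the lengths are
  Schur's 1, 4, 13.\<close>

lemma mono_free_generalized_schur:
  fixes t :: int
  assumes t: "t \<ge> 1"
  defines "M \<equiv> t ^ 3 + 4 * t\<^sup>2 + 4 * t + 1"
  shows "mono_free 1 t (t ^ 3 + 5 * t\<^sup>2 + 7 * t)
    (\<lambda>x. let q = if x < M then x else x - M + 1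
         in if q \<le> t then 0 else if q \<le> t\<^sup>2 + 2 * t then 1 else if q \<le> t\<^sup>2 + 3 * t then 0 else 2)"
    (is "mono_free 1 t ?N ?c")
  unfolding mono_free_def
proof (intro conjI ballI impI)
  fix x y z
  assume "x \<in> {1..?N}" "y \<in> {1..?N}" "z \<in> {1..?N}" and "1 * (x - y) = t * z"
  then have eq: "x = y + t * z" and xyz: "1 \<le> x" "x \<le> ?N" "1 \<le> y" "y \<le> ?N" "1 \<le> z"
    by auto
  have sq: "t\<^sup>2 \<ge> t" and cube: "t ^ 3 \<ge> t\<^sup>2"
    using t by (simp_all add: power2_eq_square power3_eq_cube)
  have M: "M \<ge> t\<^sup>2 + 3 * t + 2" "?N = M + t\<^sup>2 + 3 * t - 1"
    using t sq cube unfolding M_def by linarith+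
  have lower: "t * L \<le> t * z" if "L \<le> z" for L
    using that t by (intro mult_left_mono) auto
  have upper: "t * z \<le> t * U" if "z \<le> U" for U
    using that t by (intro mult_left_mono) auto
  \<comment> \<open>Here \<open>w\<close> is an arbitrary integer, so the last range stays open
    above; \<open>xyz\<close> supplies the bound by \<open>?N\<close>.\<close>
  have col0: "w \<le> t \<or> t\<^sup>2 + 2 * t < w \<and> w \<le> t\<^sup>2 + 3 * t \<or> M \<le> w \<and> w \<le> M + t - 1 \<or> M + t\<^sup>2 + 2 * t \<le> w"
    if "?c w = 0" for w
    using that by (auto simp: Let_def split: if_splits)
  have col1: "t < w \<and> w \<le> t\<^sup>2 + 2 * t \<or> M + t \<le> w \<and> w < M + t\<^sup>2 + 2 * t" if "?c w = 1" for w
    using that by (auto simp: Let_def split: if_splits)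
  have col2: "t\<^sup>2 + 3 * t < w \<and> (w < M \<or> M + t\<^sup>2 + 3 * t \<le> w)" if "?c w = 2" for w
    using that M sq t by (auto simp: Let_def split: if_splits)
  show "\<not> (?c x = ?c y \<and> ?c y = ?c z)"
  proof
    assume mono: "?c x = ?c y \<and> ?c y = ?c z"
    \<comment> \<open>For \<open>t \<ge> 2\<close>, a \<open>z\<close> in the last copy gives
      \<open>t * z \<ge> 2 * M > ?N\<close>. For \<open>t = 1\<close> such \<open>z\<close> do
      occur, hence the case distinctions below.\<close>
    have big: "z < M" if "t \<ge> 2"
    proof (rule ccontr)
      assume "\<not> z < M"
      moreover have "2 * z \<le> t * z"
        using that xyz by (intro mult_right_mono) auto
      ultimately show False
        using eq xyz M sq by linarith
    qed
    have "?c z = 0 \<or> ?c z = 1 \<or> ?c z = 2"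
      by (simp add: Let_def)
    then consider "?c z = 0" | "?c z = 1" | "?c z = 2"
      by argo
    then show False
    proof cases
      case 1
      then have c: "?c x = 0" "?c y = 0"
        using mono by argo+
      note cols = col0[OF 1] col0[OF c(1)] col0[OF c(2)]
      show False
      proof (cases "t = 1")
        \<comment> \<open>Here \<open>M = 10\<close> and the points of colour 0 are 1, 4, 10, 13, so
          the claim is a finite check.\<close>
        case True
        then show False
          using cols eq xyz by (simp add: M_def) presburger
      next
        case False
        then have "z < M"
          using t big by linarith
        \<comment> \<open>Points of colour 0 differ by less than \<open>t\<close> inside a block, by
          \<open>t ^ 2 + t + 1\<close> to \<open>t ^ 2 + 3 * t - 1\<close> between the two blocks of
          one copy, and by at least \<open>t ^ 3 + 3 * t ^ 2 + t + 1\<close> between the copies. The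
          two ranges of \<open>t * z\<close> bounded here avoid all of these.\<close>
        have "t * 1 \<le> t * z" and "z \<le> t \<Longrightarrow> t * z \<le> t * t"
          and "t\<^sup>2 + 2 * t + 1 \<le> z \<Longrightarrow> t * (t\<^sup>2 + 2 * t + 1) \<le> t * z"
          and "z \<le> t\<^sup>2 + 3 * t \<Longrightarrow> t * z \<le> t * (t\<^sup>2 + 3 * t)"
          using lower upper xyz by blast+
        moreover have "t * t = t\<^sup>2" "t * (t\<^sup>2 + 2 * t + 1) = t ^ 3 + 2 * t\<^sup>2 + t"
          "t * (t\<^sup>2 + 3 * t) = t ^ 3 + 3 * t\<^sup>2"
          by (simp_all add: algebra_simps power2_eq_square power3_eq_cube)
        ultimately show False
          using cols \<open>z < M\<close> eq xyz sq cube t M M_def by (smt (verit))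
      qed
    next
      case 2
      then have c: "?c x = 1" "?c y = 1"
        using mono by argo+
      note cols = col1[OF 2] col1[OF c(1)] col1[OF c(2)]
      show False
      proof (cases "z < M")
        case False
        then have "t = 1"
          using big t by linarith
        \<comment> \<open>Now \<open>z \<ge> 11\<close> and \<open>y \<ge> 2\<close>, so
          \<open>x \<ge> 13\<close>, whereas colour 1 ends at 12.\<close>
        then show False
          using False cols eq M(1) by auto
      next
        case True
        \<comment> \<open>Points of one block of colour 1 differ by at most
          \<open>t ^ 2 + t - 1\<close>, and points of different blocks by at least
          \<open>t ^ 3 + 3 * t ^ 2 + 3 * t + 1\<close>; \<open>t * z\<close> falls strictly in
          between.\<close>
        then have "t * (t + 1) \<le> t * z" and "t * z \<le> t * (t\<^sup>2 + 2 * t)"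
          using lower upper cols(1) t by auto
        moreover have "t * (t + 1) = t\<^sup>2 + t" "t * (t\<^sup>2 + 2 * t) = t ^ 3 + 2 * t\<^sup>2"
          by (simp_all add: algebra_simps power2_eq_square power3_eq_cube)
        ultimately show False
          using cols eq xyz sq cube t M_def by linarith
      qed
    next
      case 3
      then have c: "?c x = 2" "?c y = 2"
        using mono by argo+
      note cols = col2[OF 3] col2[OF c(1)] col2[OF c(2)]
      \<comment> \<open>Both \<open>y\<close> and \<open>z\<close> are at least
        \<open>t ^ 2 + 3 * t + 1\<close>, which pushes \<open>x\<close> to \<open>M\<close> or
        beyond, past the last point of colour 2.\<close>
      have "t * (t\<^sup>2 + 3 * t + 1) \<le> t * z"
        using lower cols(1) by auto
      moreover have "t * (t\<^sup>2 + 3 * t + 1) = t ^ 3 + 3 * t\<^sup>2 + t"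
        by (simp add: algebra_simps power2_eq_square power3_eq_cube)
      ultimately show False
        using cols eq xyz M M_def by linarith
    qed
  qed
qed (simp add: Let_def)


section \<open>Finite refutations\<close>

text \<open>The colours are named \<open>r\<close>, \<open>g\<close>, \<open>s\<close> instead of 0,
  1, 2 so that two points of different colours can be taken to have colours \<open>r\<close> and
  \<open>g\<close> without a case split. In the refutations \<open>cover\<close> provides one
  positive clause per point and \<open>free\<close> the negative clauses.\<close>

locale three_coloring =
  fixes a b N :: int and c :: "int \<Rightarrow> nat" and r g s :: nat
  assumes cover: "x \<in> {1..N} \<Longrightarrow> c x = r \<or> c x = g \<or> c x = s"
    and free: "x \<in> {1..N} \<Longrightarrow> y \<in> {1..N} \<Longrightarrow> z \<in> {1..N} \<Longrightarrow> a * (x - y) = b * z \<Longrightarrow>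
      \<not> (c x = c y \<and> c y = c z)"
begin

text \<open>Phrased with \<open>c x = r\<close> etc. as atoms, so that the refutations below are purely propositional.\<close>

definition not_mono :: "int \<Rightarrow> int \<Rightarrow> int \<Rightarrow> bool" where
  "not_mono x y z \<longleftrightarrow> \<not> (c x = r \<and> c y = r \<and> c z = r) \<and> \<not> (c x = g \<and> c y = g \<and> c z = g) \<and>
     \<not> (c x = s \<and> c y = s \<and> c z = s)"

lemma not_monoI:
  assumes "x \<in> {1..N}" "y \<in> {1..N}" "z \<in> {1..N}" "a * (x - y) = b * z"
  shows "not_mono x y z"
  using free[OF assms] by (auto simp: not_mono_def)

end

lemma three_coloring_of_mono_free:
  assumes "mono_free a b N c" and "p \<in> {1..N}" "q \<in> {1..N}" and "c p \<noteq> c q"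
  obtains s where "three_coloring a b N c (c p) (c q) s"
proof -
  have c: "c x < 3" if "x \<in> {1..N}" for x
    using assms(1) that by (simp add: mono_free_def)
  have "\<exists>s. \<forall>i<3. i = u \<or> i = v \<or> i = s" if "u < 3" "v < 3" "u \<noteq> v" for u v :: nat
  \<comment> \<open>The three colours sum to 3, so this is the remaining one; distinct colours have
    sum at most 3, so the subtraction on naturals does not truncate.\<close>
  proof (intro exI[of _ "3 - u - v"] allI impI)
    fix i :: nat
    assume "i < 3"
    then show "i = u \<or> i = v \<or> i = 3 - u - v"
      using that by linarith
  qed
  then obtain s where s: "\<forall>i<3. i = c p \<or> i = c q \<or> i = s"
    using c assms by meson
  have "three_coloring a b N c (c p) (c q) s"
  proof
    show "c x = c p \<or> c x = c q \<or> c x = s" if "x \<in> {1..N}" for x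
      using s c[OF that] by blast
    show "\<not> (c x = c y \<and> c y = c z)"
      if "x \<in> {1..N}" "y \<in> {1..N}" "z \<in> {1..N}" "a * (x - y) = b * z" for x y z
      using assms(1) that unfolding mono_free_def by blast
  qed
  then show thesis
    by (rule that)
qed

text \<open>
  The points and solutions in the following four lemmas were found by a search with a SAT solver
  and then thinned out.
\<close>

lemma three_coloring_generalized_schur:
  fixes t :: int
  assumes "three_coloring 1 t (t ^ 3 + 5 * t\<^sup>2 + 7 * t + 1) c r g s" and t: "t \<ge> 1"
    and init: "c (t + 1) = r" "c (t\<^sup>2 + 2 * t + 1) = g"
  shows False
proof -
  interpret three_coloring 1 t "t ^ 3 + 5 * t\<^sup>2 + 7 * t + 1" c r g s
    by fact
  \<comment> \<open>These are the powers of \<open>t - 1\<close>, expanded. They turn the polynomial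
    bounds for the points into linear problems in the monomials \<open>t\<close>,
    \<open>t ^ 2\<close>, \<open>t ^ 3\<close>.\<close>
  have nl: "t \<ge> 1" "t\<^sup>2 - 2 * t + 1 \<ge> 0" "t ^ 3 - 3 * t\<^sup>2 + 3 * t - 1 \<ge> 0"
    using t zero_le_power[of "t - 1" 2] zero_le_power[of "t - 1" 3]
    by (simp_all add: power2_eq_square power3_eq_cube algebra_simps)
  \<comment> \<open>The right end of the interval must occur among the points, because the interval
    without it has a good colouring.\<close>
  have pts:
    "1 \<in> {1..t ^ 3 + 5 * t\<^sup>2 + 7 * t + 1}" "2 \<in> {1..t ^ 3 + 5 * t\<^sup>2 + 7 * t + 1}"
    "t \<in> {1..t ^ 3 + 5 * t\<^sup>2 + 7 * t + 1}" "t + 1 \<in> {1..t ^ 3 + 5 * t\<^sup>2 + 7 * t + 1}"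
    "t + 2 \<in> {1..t ^ 3 + 5 * t\<^sup>2 + 7 * t + 1}" "t + 3 \<in> {1..t ^ 3 + 5 * t\<^sup>2 + 7 * t + 1}"
    "2 * t + 1 \<in> {1..t ^ 3 + 5 * t\<^sup>2 + 7 * t + 1}"
    "2 * t + 2 \<in> {1..t ^ 3 + 5 * t\<^sup>2 + 7 * t + 1}"
    "3 * t + 1 \<in> {1..t ^ 3 + 5 * t\<^sup>2 + 7 * t + 1}"
    "t\<^sup>2 + t \<in> {1..t ^ 3 + 5 * t\<^sup>2 + 7 * t + 1}"
    "t\<^sup>2 + 2 * t \<in> {1..t ^ 3 + 5 * t\<^sup>2 + 7 * t + 1}"
    "t\<^sup>2 + t + 1 \<in> {1..t ^ 3 + 5 * t\<^sup>2 + 7 * t + 1}"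
    "t\<^sup>2 + 2 * t + 1 \<in> {1..t ^ 3 + 5 * t\<^sup>2 + 7 * t + 1}"
    "t\<^sup>2 + 3 * t + 1 \<in> {1..t ^ 3 + 5 * t\<^sup>2 + 7 * t + 1}"
    "t\<^sup>2 + 3 * t + 2 \<in> {1..t ^ 3 + 5 * t\<^sup>2 + 7 * t + 1}"
    "t\<^sup>2 + 3 * t + 3 \<in> {1..t ^ 3 + 5 * t\<^sup>2 + 7 * t + 1}"
    "t\<^sup>2 + 4 * t + 1 \<in> {1..t ^ 3 + 5 * t\<^sup>2 + 7 * t + 1}"
    "t\<^sup>2 + 4 * t + 2 \<in> {1..t ^ 3 + 5 * t\<^sup>2 + 7 * t + 1}"
    "t\<^sup>2 + 4 * t + 3 \<in> {1..t ^ 3 + 5 * t\<^sup>2 + 7 * t + 1}"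
    "2 * t\<^sup>2 + 2 * t + 1 \<in> {1..t ^ 3 + 5 * t\<^sup>2 + 7 * t + 1}"
    "2 * t\<^sup>2 + 3 * t + 1 \<in> {1..t ^ 3 + 5 * t\<^sup>2 + 7 * t + 1}"
    "2 * t\<^sup>2 + 4 * t + 1 \<in> {1..t ^ 3 + 5 * t\<^sup>2 + 7 * t + 1}"
    "2 * t\<^sup>2 + 5 * t + 1 \<in> {1..t ^ 3 + 5 * t\<^sup>2 + 7 * t + 1}"
    "t ^ 3 + 2 * t\<^sup>2 + t + 1 \<in> {1..t ^ 3 + 5 * t\<^sup>2 + 7 * t + 1}"
    "t ^ 3 + 2 * t\<^sup>2 + 2 * t + 1 \<in> {1..t ^ 3 + 5 * t\<^sup>2 + 7 * t + 1}"
    "t ^ 3 + 2 * t\<^sup>2 + 3 * t + 1 \<in> {1..t ^ 3 + 5 * t\<^sup>2 + 7 * t + 1}"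
    "t ^ 3 + 3 * t\<^sup>2 + 2 * t + 1 \<in> {1..t ^ 3 + 5 * t\<^sup>2 + 7 * t + 1}"
    "t ^ 3 + 3 * t\<^sup>2 + 3 * t + 1 \<in> {1..t ^ 3 + 5 * t\<^sup>2 + 7 * t + 1}"
    "t ^ 3 + 3 * t\<^sup>2 + 4 * t + 1 \<in> {1..t ^ 3 + 5 * t\<^sup>2 + 7 * t + 1}"
    "t ^ 3 + 4 * t\<^sup>2 + 3 * t + 1 \<in> {1..t ^ 3 + 5 * t\<^sup>2 + 7 * t + 1}"
    "t ^ 3 + 4 * t\<^sup>2 + 4 * t + 1 \<in> {1..t ^ 3 + 5 * t\<^sup>2 + 7 * t + 1}"
    "t ^ 3 + 4 * t\<^sup>2 + 5 * t + 1 \<in> {1..t ^ 3 + 5 * t\<^sup>2 + 7 * t + 1}"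
    "t ^ 3 + 5 * t\<^sup>2 + 4 * t + 1 \<in> {1..t ^ 3 + 5 * t\<^sup>2 + 7 * t + 1}"
    "t ^ 3 + 5 * t\<^sup>2 + 5 * t + 1 \<in> {1..t ^ 3 + 5 * t\<^sup>2 + 7 * t + 1}"
    "t ^ 3 + 5 * t\<^sup>2 + 6 * t + 1 \<in> {1..t ^ 3 + 5 * t\<^sup>2 + 7 * t + 1}"
    "t ^ 3 + 5 * t\<^sup>2 + 7 * t + 1 \<in> {1..t ^ 3 + 5 * t\<^sup>2 + 7 * t + 1}"
    by (rule atLeastAtMost_iff[THEN iffD2, OF conjI]; insert nl; linarith)+
  have sols:
    "not_mono (t\<^sup>2 + 3 * t + 1) (t\<^sup>2 + t + 1) (2)" "not_mono (t\<^sup>2 + 2 * t + 1) (1) (t + 2)"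
    "not_mono (t ^ 3 + 4 * t\<^sup>2 + 4 * t + 1) (t ^ 3 + 3 * t\<^sup>2 + 4 * t + 1) (t)"
    "not_mono (t ^ 3 + 5 * t\<^sup>2 + 5 * t + 1) (t ^ 3 + 3 * t\<^sup>2 + 3 * t + 1) (2 * t + 2)"
    "not_mono (t ^ 3 + 5 * t\<^sup>2 + 7 * t + 1) (2 * t\<^sup>2 + 5 * t + 1) (t\<^sup>2 + 3 * t + 2)"
    "not_mono (t\<^sup>2 + t) (t) (t)"
    "not_mono (t ^ 3 + 4 * t\<^sup>2 + 3 * t + 1) (2 * t\<^sup>2 + 2 * t + 1) (t\<^sup>2 + 2 * t + 1)"
    "not_mono (t ^ 3 + 5 * t\<^sup>2 + 5 * t + 1) (t ^ 3 + 5 * t\<^sup>2 + 4 * t + 1) (1)"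
    "not_mono (t ^ 3 + 2 * t\<^sup>2 + t + 1) (t\<^sup>2 + t + 1) (t\<^sup>2 + t)"
    "not_mono (3 * t + 1) (t + 1) (2)"
    "not_mono (t ^ 3 + 5 * t\<^sup>2 + 7 * t + 1) (t\<^sup>2 + 4 * t + 1) (t\<^sup>2 + 4 * t + 3)"
    "not_mono (t ^ 3 + 3 * t\<^sup>2 + 2 * t + 1) (1) (t\<^sup>2 + 3 * t + 2)"
    "not_mono (t ^ 3 + 5 * t\<^sup>2 + 7 * t + 1) (t ^ 3 + 5 * t\<^sup>2 + 6 * t + 1) (1)"
    "not_mono (t ^ 3 + 4 * t\<^sup>2 + 4 * t + 1) (t\<^sup>2 + 3 * t + 1) (t\<^sup>2 + 3 * t + 1)"
    "not_mono (t ^ 3 + 2 * t\<^sup>2 + 3 * t + 1) (t ^ 3 + 2 * t\<^sup>2 + 2 * t + 1) (1)"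
    "not_mono (t ^ 3 + 5 * t\<^sup>2 + 6 * t + 1) (t ^ 3 + 4 * t\<^sup>2 + 5 * t + 1) (t + 1)"
    "not_mono (t ^ 3 + 4 * t\<^sup>2 + 4 * t + 1) (t\<^sup>2 + 2 * t + 1) (t\<^sup>2 + 3 * t + 2)"
    "not_mono (2 * t\<^sup>2 + 4 * t + 1) (t\<^sup>2 + 2 * t + 1) (t + 2)"
    "not_mono (t ^ 3 + 2 * t\<^sup>2 + 3 * t + 1) (2 * t + 1) (t\<^sup>2 + 2 * t + 1)"
    "not_mono (t ^ 3 + 4 * t\<^sup>2 + 4 * t + 1) (3 * t + 1) (t\<^sup>2 + 4 * t + 1)"
    "not_mono (t ^ 3 + 4 * t\<^sup>2 + 4 * t + 1) (t ^ 3 + 4 * t\<^sup>2 + 3 * t + 1) (1)"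
    "not_mono (t ^ 3 + 5 * t\<^sup>2 + 6 * t + 1) (t ^ 3 + 4 * t\<^sup>2 + 4 * t + 1) (t + 2)"
    "not_mono (t ^ 3 + 5 * t\<^sup>2 + 7 * t + 1) (t ^ 3 + 4 * t\<^sup>2 + 5 * t + 1) (t + 2)"
    "not_mono (t ^ 3 + 3 * t\<^sup>2 + 4 * t + 1) (t ^ 3 + 3 * t\<^sup>2 + 2 * t + 1) (2)"
    "not_mono (t ^ 3 + 3 * t\<^sup>2 + 2 * t + 1) (t\<^sup>2 + 2 * t + 1) (t\<^sup>2 + 2 * t)"
    "not_mono (t ^ 3 + 4 * t\<^sup>2 + 5 * t + 1) (t ^ 3 + 4 * t\<^sup>2 + 4 * t + 1) (1)"
    "not_mono (t ^ 3 + 3 * t\<^sup>2 + 4 * t + 1) (t\<^sup>2 + 3 * t + 1) (t\<^sup>2 + 2 * t + 1)"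
    "not_mono (2 * t\<^sup>2 + 5 * t + 1) (t\<^sup>2 + 4 * t + 1) (t + 1)"
    "not_mono (t ^ 3 + 5 * t\<^sup>2 + 4 * t + 1) (t ^ 3 + 3 * t\<^sup>2 + 2 * t + 1) (2 * t + 2)"
    "not_mono (t ^ 3 + 2 * t\<^sup>2 + t + 1) (1) (t\<^sup>2 + 2 * t + 1)"
    "not_mono (t ^ 3 + 3 * t\<^sup>2 + 3 * t + 1) (2 * t\<^sup>2 + 2 * t + 1) (t\<^sup>2 + t + 1)"
    "not_mono (t\<^sup>2 + 3 * t + 1) (t + 1) (t + 2)"
    "not_mono (t ^ 3 + 4 * t\<^sup>2 + 5 * t + 1) (2 * t + 1) (t\<^sup>2 + 4 * t + 3)"
    "not_mono (2 * t\<^sup>2 + 3 * t + 1) (t\<^sup>2 + 3 * t + 1) (t)"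
    "not_mono (t ^ 3 + 2 * t\<^sup>2 + t + 1) (t + 1) (t\<^sup>2 + 2 * t)"
    "not_mono (t ^ 3 + 4 * t\<^sup>2 + 3 * t + 1) (2 * t\<^sup>2 + 3 * t + 1) (t\<^sup>2 + 2 * t)"
    "not_mono (2 * t\<^sup>2 + 2 * t + 1) (t + 1) (2 * t + 1)"
    "not_mono (t ^ 3 + 3 * t\<^sup>2 + 3 * t + 1) (t + 1) (t\<^sup>2 + 3 * t + 2)"
    "not_mono (t ^ 3 + 4 * t\<^sup>2 + 5 * t + 1) (2 * t\<^sup>2 + 4 * t + 1) (t\<^sup>2 + 2 * t + 1)"
    "not_mono (t ^ 3 + 5 * t\<^sup>2 + 6 * t + 1) (2 * t\<^sup>2 + 4 * t + 1) (t\<^sup>2 + 3 * t + 2)"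
    "not_mono (2 * t\<^sup>2 + 5 * t + 1) (2 * t\<^sup>2 + 4 * t + 1) (1)"
    "not_mono (t\<^sup>2 + 4 * t + 2) (t\<^sup>2 + 3 * t + 2) (1)"
    "not_mono (2 * t\<^sup>2 + 2 * t + 1) (t\<^sup>2 + 2 * t + 1) (t)"
    "not_mono (t ^ 3 + 4 * t\<^sup>2 + 4 * t + 1) (t\<^sup>2 + t + 1) (t\<^sup>2 + 3 * t + 3)"
    "not_mono (t ^ 3 + 3 * t\<^sup>2 + 3 * t + 1) (t\<^sup>2 + 2 * t + 1) (t\<^sup>2 + 2 * t + 1)"
    "not_mono (t ^ 3 + 3 * t\<^sup>2 + 4 * t + 1) (t ^ 3 + 2 * t\<^sup>2 + 3 * t + 1) (t + 1)"
    "not_mono (t ^ 3 + 4 * t\<^sup>2 + 4 * t + 1) (2 * t\<^sup>2 + 4 * t + 1) (t\<^sup>2 + 2 * t)"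
    "not_mono (t ^ 3 + 5 * t\<^sup>2 + 5 * t + 1) (t ^ 3 + 4 * t\<^sup>2 + 4 * t + 1) (t + 1)"
    "not_mono (t\<^sup>2 + 4 * t + 1) (t + 1) (t + 3)"
    "not_mono (2 * t\<^sup>2 + 4 * t + 1) (t\<^sup>2 + t + 1) (t + 3)" "not_mono (2 * t + 2) (t + 2) (1)"
    "not_mono (2 * t\<^sup>2 + 4 * t + 1) (2 * t\<^sup>2 + 2 * t + 1) (2)"
    "not_mono (t ^ 3 + 3 * t\<^sup>2 + 3 * t + 1) (t\<^sup>2 + 3 * t + 1) (t\<^sup>2 + 2 * t)"
    "not_mono (t\<^sup>2 + 4 * t + 1) (2 * t + 1) (t + 2)"
    "not_mono (2 * t\<^sup>2 + 4 * t + 1) (t\<^sup>2 + 3 * t + 1) (t + 1)"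
    "not_mono (t ^ 3 + 5 * t\<^sup>2 + 7 * t + 1) (t ^ 3 + 4 * t\<^sup>2 + 4 * t + 1) (t + 3)"
    "not_mono (t ^ 3 + 4 * t\<^sup>2 + 5 * t + 1) (t ^ 3 + 3 * t\<^sup>2 + 3 * t + 1) (t + 2)"
    "not_mono (2 * t\<^sup>2 + 4 * t + 1) (2 * t\<^sup>2 + 3 * t + 1) (1)"
    "not_mono (2 * t\<^sup>2 + 5 * t + 1) (t\<^sup>2 + 3 * t + 1) (t + 2)"
    "not_mono (t\<^sup>2 + 2 * t) (t\<^sup>2 + t) (1)"
    "not_mono (t ^ 3 + 3 * t\<^sup>2 + 2 * t + 1) (t\<^sup>2 + t + 1) (t\<^sup>2 + 2 * t + 1)"
    "not_mono (t ^ 3 + 4 * t\<^sup>2 + 3 * t + 1) (t ^ 3 + 3 * t\<^sup>2 + 3 * t + 1) (t)"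
    "not_mono (t ^ 3 + 4 * t\<^sup>2 + 4 * t + 1) (t ^ 3 + 3 * t\<^sup>2 + 3 * t + 1) (t + 1)"
    "not_mono (t ^ 3 + 2 * t\<^sup>2 + 2 * t + 1) (t ^ 3 + 2 * t\<^sup>2 + t + 1) (1)"
    "not_mono (t ^ 3 + 4 * t\<^sup>2 + 4 * t + 1) (t + 1) (t\<^sup>2 + 4 * t + 3)"
    "not_mono (t ^ 3 + 3 * t\<^sup>2 + 2 * t + 1) (t + 1) (t\<^sup>2 + 3 * t + 1)"
    "not_mono (t ^ 3 + 3 * t\<^sup>2 + 3 * t + 1) (2 * t + 1) (t\<^sup>2 + 3 * t + 1)"
    "not_mono (t\<^sup>2 + 3 * t + 3) (t + 3) (t + 2)" "not_mono (t\<^sup>2 + 4 * t + 3) (t + 3) (t + 3)"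
    "not_mono (t ^ 3 + 3 * t\<^sup>2 + 4 * t + 1) (3 * t + 1) (t\<^sup>2 + 3 * t + 1)"
    "not_mono (2 * t\<^sup>2 + 4 * t + 1) (t\<^sup>2 + 4 * t + 1) (t)"
    "not_mono (t ^ 3 + 5 * t\<^sup>2 + 5 * t + 1) (2 * t\<^sup>2 + 3 * t + 1) (t\<^sup>2 + 3 * t + 2)"
    "not_mono (t ^ 3 + 5 * t\<^sup>2 + 5 * t + 1) (t ^ 3 + 3 * t\<^sup>2 + 4 * t + 1) (2 * t + 1)"
    "not_mono (t ^ 3 + 3 * t\<^sup>2 + 3 * t + 1) (t ^ 3 + 3 * t\<^sup>2 + 2 * t + 1) (1)"
    "not_mono (t\<^sup>2 + 2 * t + 1) (2 * t + 1) (t)"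
    "not_mono (t ^ 3 + 3 * t\<^sup>2 + 4 * t + 1) (t ^ 3 + 2 * t\<^sup>2 + t + 1) (t + 3)"
    "not_mono (t\<^sup>2 + 3 * t + 1) (2 * t + 1) (t + 1)"
    "not_mono (t\<^sup>2 + 3 * t + 1) (t\<^sup>2 + 2 * t + 1) (1)"
    "not_mono (t\<^sup>2 + 4 * t + 1) (t\<^sup>2 + 3 * t + 1) (1)"
    "not_mono (t ^ 3 + 4 * t\<^sup>2 + 5 * t + 1) (2 * t\<^sup>2 + 5 * t + 1) (t\<^sup>2 + 2 * t)"
    "not_mono (t ^ 3 + 4 * t\<^sup>2 + 4 * t + 1) (t ^ 3 + 3 * t\<^sup>2 + 2 * t + 1) (t + 2)"
    "not_mono (t ^ 3 + 3 * t\<^sup>2 + 3 * t + 1) (t ^ 3 + 2 * t\<^sup>2 + t + 1) (t + 2)"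
    "not_mono (t ^ 3 + 5 * t\<^sup>2 + 5 * t + 1) (t\<^sup>2 + 4 * t + 1) (t\<^sup>2 + 4 * t + 1)"
    "not_mono (2 * t\<^sup>2 + 3 * t + 1) (2 * t\<^sup>2 + 2 * t + 1) (1)"
    "not_mono (t ^ 3 + 5 * t\<^sup>2 + 6 * t + 1) (t ^ 3 + 5 * t\<^sup>2 + 4 * t + 1) (2)"
    "not_mono (t ^ 3 + 3 * t\<^sup>2 + 3 * t + 1) (1) (t\<^sup>2 + 3 * t + 3)" "not_mono (2 * t + 1) (1) (2)"
    "not_mono (t ^ 3 + 5 * t\<^sup>2 + 6 * t + 1) (t ^ 3 + 3 * t\<^sup>2 + 4 * t + 1) (2 * t + 2)"
    "not_mono (t ^ 3 + 5 * t\<^sup>2 + 5 * t + 1) (t\<^sup>2 + 2 * t + 1) (t\<^sup>2 + 4 * t + 3)"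
    "not_mono (t ^ 3 + 5 * t\<^sup>2 + 4 * t + 1) (t ^ 3 + 4 * t\<^sup>2 + 4 * t + 1) (t)"
    "not_mono (t\<^sup>2 + 4 * t + 3) (t\<^sup>2 + 3 * t + 3) (1)"
    "not_mono (t\<^sup>2 + 3 * t + 2) (t + 2) (t + 2)"
    "not_mono (t ^ 3 + 5 * t\<^sup>2 + 5 * t + 1) (t\<^sup>2 + 3 * t + 1) (t\<^sup>2 + 4 * t + 2)"
    "not_mono (t\<^sup>2 + 3 * t + 1) (1) (t + 3)"
    "not_mono (t ^ 3 + 3 * t\<^sup>2 + 3 * t + 1) (2 * t\<^sup>2 + 3 * t + 1) (t\<^sup>2 + t)"
    "not_mono (t ^ 3 + 3 * t\<^sup>2 + 4 * t + 1) (t + 1) (t\<^sup>2 + 3 * t + 3)"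
    "not_mono (t\<^sup>2 + 4 * t + 1) (t\<^sup>2 + 2 * t + 1) (2)"
    "not_mono (t ^ 3 + 5 * t\<^sup>2 + 6 * t + 1) (t ^ 3 + 5 * t\<^sup>2 + 5 * t + 1) (1)"
    "not_mono (2 * t\<^sup>2 + 3 * t + 1) (t\<^sup>2 + t + 1) (t + 2)"
    "not_mono (t\<^sup>2 + 2 * t + 1) (t\<^sup>2 + t + 1) (1)"
    "not_mono (2 * t\<^sup>2 + 4 * t + 1) (3 * t + 1) (2 * t + 1)"
    "not_mono (t ^ 3 + 2 * t\<^sup>2 + 2 * t + 1) (t\<^sup>2 + 2 * t + 1) (t\<^sup>2 + t)"
    "not_mono (t ^ 3 + 5 * t\<^sup>2 + 5 * t + 1) (2 * t\<^sup>2 + 2 * t + 1) (t\<^sup>2 + 3 * t + 3)"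
    "not_mono (t\<^sup>2 + 2 * t) (t) (t + 1)"
    "not_mono (t ^ 3 + 5 * t\<^sup>2 + 4 * t + 1) (t ^ 3 + 4 * t\<^sup>2 + 3 * t + 1) (t + 1)"
    "not_mono (t ^ 3 + 4 * t\<^sup>2 + 3 * t + 1) (t + 1) (t\<^sup>2 + 4 * t + 2)"
    "not_mono (t ^ 3 + 4 * t\<^sup>2 + 3 * t + 1) (t ^ 3 + 3 * t\<^sup>2 + 2 * t + 1) (t + 1)"
    "not_mono (t ^ 3 + 4 * t\<^sup>2 + 5 * t + 1) (t\<^sup>2 + 2 * t + 1) (t\<^sup>2 + 3 * t + 3)"
    "not_mono (t ^ 3 + 2 * t\<^sup>2 + 2 * t + 1) (t\<^sup>2 + t + 1) (t\<^sup>2 + t + 1)"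
    "not_mono (t ^ 3 + 5 * t\<^sup>2 + 6 * t + 1) (t\<^sup>2 + 3 * t + 1) (t\<^sup>2 + 4 * t + 3)"
    "not_mono (2 * t\<^sup>2 + 4 * t + 1) (2 * t + 1) (2 * t + 2)"
    "not_mono (t ^ 3 + 4 * t\<^sup>2 + 3 * t + 1) (t\<^sup>2 + 2 * t + 1) (t\<^sup>2 + 3 * t + 1)"
    "not_mono (t ^ 3 + 4 * t\<^sup>2 + 4 * t + 1) (2 * t + 1) (t\<^sup>2 + 4 * t + 2)"
    "not_mono (2 * t + 2) (2) (2)"
    "not_mono (t ^ 3 + 5 * t\<^sup>2 + 4 * t + 1) (t\<^sup>2 + 2 * t + 1) (t\<^sup>2 + 4 * t + 2)"
    "not_mono (t + 1) (1) (1)"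
    "not_mono (t ^ 3 + 3 * t\<^sup>2 + 4 * t + 1) (t\<^sup>2 + 4 * t + 1) (t\<^sup>2 + 2 * t)"
    "not_mono (t ^ 3 + 5 * t\<^sup>2 + 6 * t + 1) (2 * t\<^sup>2 + 3 * t + 1) (t\<^sup>2 + 3 * t + 3)"
    "not_mono (t ^ 3 + 4 * t\<^sup>2 + 5 * t + 1) (t ^ 3 + 3 * t\<^sup>2 + 4 * t + 1) (t + 1)"
    "not_mono (t ^ 3 + 5 * t\<^sup>2 + 7 * t + 1) (2 * t\<^sup>2 + 4 * t + 1) (t\<^sup>2 + 3 * t + 3)"
    "not_mono (3 * t + 1) (2 * t + 1) (1)"
    "not_mono (2 * t\<^sup>2 + 5 * t + 1) (t\<^sup>2 + 2 * t + 1) (t + 3)"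
    "not_mono (2 * t\<^sup>2 + 3 * t + 1) (2 * t + 1) (2 * t + 1)" "not_mono (t\<^sup>2 + t + 1) (t + 1) (t)"
    "not_mono (t ^ 3 + 3 * t\<^sup>2 + 3 * t + 1) (t ^ 3 + 2 * t\<^sup>2 + 3 * t + 1) (t)"
    "not_mono (t ^ 3 + 3 * t\<^sup>2 + 4 * t + 1) (t ^ 3 + 3 * t\<^sup>2 + 3 * t + 1) (1)"
    "not_mono (t ^ 3 + 4 * t\<^sup>2 + 4 * t + 1) (2 * t\<^sup>2 + 3 * t + 1) (t\<^sup>2 + 2 * t + 1)"
    "not_mono (t ^ 3 + 5 * t\<^sup>2 + 5 * t + 1) (t ^ 3 + 4 * t\<^sup>2 + 5 * t + 1) (t)"
    "not_mono (2 * t\<^sup>2 + 3 * t + 1) (t + 1) (2 * t + 2)"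
    "not_mono (t ^ 3 + 3 * t\<^sup>2 + 3 * t + 1) (t ^ 3 + 2 * t\<^sup>2 + 2 * t + 1) (t + 1)"
    "not_mono (t ^ 3 + 4 * t\<^sup>2 + 5 * t + 1) (t\<^sup>2 + 3 * t + 1) (t\<^sup>2 + 3 * t + 2)"
    "not_mono (t\<^sup>2 + 3 * t + 1) (3 * t + 1) (t)"
    by ((rule not_monoI, (fact pts)+, algebra)+)
  \<comment> \<open>Two unit clauses from \<open>init\<close>, one disjunction of three colours per
    point, and three forbidden patterns per solution are propositionally inconsistent.\<close>
  show False
    using init pts[THEN cover] sols
    unfolding not_mono_def by sat
qed

lemma three_coloring_pred:
  fixes a :: int
  assumes "three_coloring a (a - 1) (a ^ 3 + (a - 1)\<^sup>2) c r g s" and a: "a \<ge> 3"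
    and init: "c (a\<^sup>2) = r" "c a = g"
  shows False
proof -
  define N where "N = a ^ 3 + (a - 1)\<^sup>2"
  interpret three_coloring a "a - 1" N c r g s
    unfolding N_def by fact
  \<comment> \<open>The same device, now centred at the smallest value \<open>a = 3\<close>: powers
    of \<open>a - 3\<close>, together with the expansion of \<open>N\<close>, which the bounds need
    in monomial form.\<close>
  have nl: "a \<ge> 3" "a\<^sup>2 \<ge> 3 * a" "a ^ 3 \<ge> 3 * a\<^sup>2" "a\<^sup>2 - 6 * a + 9 \<ge> 0"
    "a ^ 3 - 9 * a\<^sup>2 + 27 * a - 27 \<ge> 0" "N = a ^ 3 + a\<^sup>2 - 2 * a + 1"
    using a zero_le_power[of "a - 3" 2] zero_le_power[of "a - 3" 3]
    by (simp_all add: N_def power2_eq_square power3_eq_cube algebra_simps)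
  \<comment> \<open>The tightest lower bounds rest on \<open>a \<ge> 3\<close>: for instance
    \<open>a ^ 3 + a - 3 * a ^ 2\<close> is 3 at \<open>a = 3\<close> but negative at
    \<open>a = 2\<close>. The right end \<open>N\<close> appears as
    \<open>a ^ 3 + a ^ 2 + 1 - 2 * a\<close>.\<close>
  have pts:
    "1 \<in> {1..N}" "a \<in> {1..N}" "a\<^sup>2 \<in> {1..N}" "a ^ 3 \<in> {1..N}" "2 * a \<in> {1..N}"
    "2 * a\<^sup>2 \<in> {1..N}" "2 * a - 1 \<in> {1..N}" "2 * a\<^sup>2 - 1 \<in> {1..N}"
    "a\<^sup>2 + a \<in> {1..N}" "a\<^sup>2 - a \<in> {1..N}" "a ^ 3 + a \<in> {1..N}"
    "a ^ 3 - a\<^sup>2 \<in> {1..N}" "a ^ 3 - 2 * a\<^sup>2 \<in> {1..N}" "2 * a\<^sup>2 - a \<in> {1..N}"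
    "a\<^sup>2 + a - 1 \<in> {1..N}" "a\<^sup>2 + 1 - a \<in> {1..N}" "a\<^sup>2 + 2 - 2 * a \<in> {1..N}"
    "a ^ 3 + a - 1 \<in> {1..N}" "a ^ 3 + 1 - a \<in> {1..N}" "a ^ 3 + 1 - a\<^sup>2 \<in> {1..N}"
    "2 * a\<^sup>2 + 1 - 2 * a \<in> {1..N}" "2 * a\<^sup>2 + 2 - 3 * a \<in> {1..N}"
    "a ^ 3 + a - a\<^sup>2 \<in> {1..N}" "a ^ 3 - a\<^sup>2 - a \<in> {1..N}"
    "a ^ 3 + a - 2 * a\<^sup>2 \<in> {1..N}" "a ^ 3 + 2 * a - 2 * a\<^sup>2 \<in> {1..N}"
    "a ^ 3 + a - 3 * a\<^sup>2 \<in> {1..N}" "a ^ 3 + a\<^sup>2 + 1 - 2 * a \<in> {1..N}"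
    "a ^ 3 + 2 * a - a\<^sup>2 - 1 \<in> {1..N}" "a ^ 3 + a + 1 - 2 * a\<^sup>2 \<in> {1..N}"
    "a ^ 3 + 3 * a - 2 * a\<^sup>2 - 1 \<in> {1..N}"
    by (rule atLeastAtMost_iff[THEN iffD2, OF conjI]; insert nl; linarith)+
  have sols:
    "not_mono (2 * a\<^sup>2 + 1 - 2 * a) (a\<^sup>2) (a\<^sup>2 - a)"
    "not_mono (a ^ 3 + 2 * a - a\<^sup>2 - 1) (2 * a\<^sup>2 - 1) (a ^ 3 - 2 * a\<^sup>2)"
    "not_mono (a ^ 3 + a\<^sup>2 + 1 - 2 * a) (2 * a\<^sup>2 + 1 - 2 * a) (a ^ 3)"
    "not_mono (2 * a\<^sup>2 - 1) (2 * a\<^sup>2 - a) (a)"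
    "not_mono (2 * a\<^sup>2 + 1 - 2 * a) (1) (2 * a\<^sup>2)"
    "not_mono (a ^ 3 + a + 1 - 2 * a\<^sup>2) (a\<^sup>2 + 1 - a) (a ^ 3 - 2 * a\<^sup>2)"
    "not_mono (a ^ 3 + 2 * a - 2 * a\<^sup>2) (a\<^sup>2 + 2 - 2 * a) (a ^ 3 + 2 * a - 2 * a\<^sup>2)"
    "not_mono (a ^ 3 + 1 - a) (a ^ 3 + a + 1 - 2 * a\<^sup>2) (2 * a\<^sup>2)"
    "not_mono (2 * a\<^sup>2 + 1 - 2 * a) (a\<^sup>2 + 2 - 2 * a) (a\<^sup>2 + a)"
    "not_mono (a\<^sup>2 + 1 - a) (a\<^sup>2 + 2 - 2 * a) (a)"
    "not_mono (a ^ 3 + 2 * a - a\<^sup>2 - 1) (a ^ 3 + 1 - a\<^sup>2) (2 * a)"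
    "not_mono (a ^ 3 + a - 2 * a\<^sup>2) (a\<^sup>2 - a) (a ^ 3 - 2 * a\<^sup>2)"
    "not_mono (2 * a\<^sup>2 - a) (a\<^sup>2 + a - 1) (a\<^sup>2 - a)"
    "not_mono (a\<^sup>2) (1) (a\<^sup>2 + a)"
    "not_mono (2 * a\<^sup>2 - a) (a\<^sup>2 + 1 - a) (a\<^sup>2 + a)"
    "not_mono (a ^ 3 + 2 * a - a\<^sup>2 - 1) (2 * a\<^sup>2 - a) (a ^ 3 + a - 2 * a\<^sup>2)"
    "not_mono (a ^ 3 + 1 - a\<^sup>2) (a ^ 3 + a + 1 - 2 * a\<^sup>2) (a\<^sup>2)"
    "not_mono (2 * a\<^sup>2 + 1 - 2 * a) (a\<^sup>2 + 1 - a) (a\<^sup>2)"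
    "not_mono (a\<^sup>2 + 1 - a) (1) (a\<^sup>2)"
    "not_mono (a ^ 3 + a\<^sup>2 + 1 - 2 * a) (a ^ 3 + 1 - a\<^sup>2) (2 * a\<^sup>2)" "not_mono (a) (1) (a)"
    "not_mono (a\<^sup>2 + a - 1) (2 * a - 1) (a\<^sup>2)" "not_mono (2 * a\<^sup>2) (2 * a) (2 * a\<^sup>2)"
    "not_mono (a ^ 3 + a\<^sup>2 + 1 - 2 * a) (a ^ 3 + a - a\<^sup>2) (2 * a\<^sup>2 - a)"
    "not_mono (a\<^sup>2 + 1 - a) (a) (a\<^sup>2 - a)"
    "not_mono (a ^ 3 + 2 * a - 2 * a\<^sup>2) (a) (a ^ 3 - a\<^sup>2)"
    "not_mono (2 * a\<^sup>2 - 1) (2 * a\<^sup>2 + 1 - 2 * a) (2 * a)"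
    "not_mono (a ^ 3) (2 * a\<^sup>2 - 1) (a ^ 3 - a\<^sup>2 - a)"
    "not_mono (a\<^sup>2 + 2 - 2 * a) (1) (a\<^sup>2 - a)"
    "not_mono (a ^ 3 + 1 - a) (a ^ 3 + a - a\<^sup>2) (a\<^sup>2 - a)"
    "not_mono (a ^ 3 + 3 * a - 2 * a\<^sup>2 - 1) (2 * a\<^sup>2 - a) (a ^ 3 + a - 3 * a\<^sup>2)"
    "not_mono (a ^ 3 + a - a\<^sup>2) (a ^ 3 + 2 * a - 2 * a\<^sup>2) (a\<^sup>2)"
    "not_mono (a ^ 3 + 1 - a\<^sup>2) (a\<^sup>2) (a ^ 3 - a\<^sup>2 - a)"
    "not_mono (a ^ 3 + a - a\<^sup>2) (2 * a\<^sup>2 + 2 - 3 * a) (a ^ 3 + 2 * a - 2 * a\<^sup>2)"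
    "not_mono (a\<^sup>2 + a - 1) (a) (a\<^sup>2 + a)"
    "not_mono (a ^ 3 + a - a\<^sup>2) (2 * a\<^sup>2 - a) (a ^ 3 - 2 * a\<^sup>2)"
    "not_mono (2 * a\<^sup>2 - 1) (a\<^sup>2 + a - 1) (a\<^sup>2)"
    "not_mono (a\<^sup>2 + a - 1) (a\<^sup>2 + 1 - a) (2 * a)"
    "not_mono (2 * a\<^sup>2 + 1 - 2 * a) (a) (2 * a\<^sup>2 - a)"
    "not_mono (a ^ 3 + a - a\<^sup>2) (1) (a ^ 3 + a)" "not_mono (2 * a - 1) (a) (a)"
    "not_mono (a ^ 3 + a - a\<^sup>2) (a ^ 3 + 1 - a\<^sup>2) (a)"
    "not_mono (a ^ 3 + a - a\<^sup>2) (a ^ 3 + a + 1 - 2 * a\<^sup>2) (a\<^sup>2 + a)"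
    "not_mono (a ^ 3 - a\<^sup>2 - a) (a ^ 3 + a - 3 * a\<^sup>2) (2 * a\<^sup>2)"
    "not_mono (a ^ 3 + a - a\<^sup>2) (a ^ 3 + 3 * a - 2 * a\<^sup>2 - 1) (a\<^sup>2 - a)"
    "not_mono (a ^ 3 + 2 * a - a\<^sup>2 - 1) (a\<^sup>2 + a - 1) (a ^ 3 - a\<^sup>2)"
    "not_mono (a ^ 3 + 2 * a - a\<^sup>2 - 1) (2 * a - 1) (a ^ 3)"
    "not_mono (2 * a\<^sup>2 - 1) (2 * a - 1) (2 * a\<^sup>2)"
    "not_mono (a ^ 3 + 2 * a - 2 * a\<^sup>2) (2 * a\<^sup>2 + 1 - 2 * a) (a ^ 3 + a - 3 * a\<^sup>2)"
    "not_mono (a ^ 3) (a ^ 3 + 3 * a - 2 * a\<^sup>2 - 1) (2 * a\<^sup>2 - a)"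
    "not_mono (a ^ 3) (a ^ 3 + 2 * a - a\<^sup>2 - 1) (a\<^sup>2 - a)"
    "not_mono (a ^ 3 + 1 - a) (2 * a\<^sup>2 + 2 - 3 * a) (a ^ 3 + a - a\<^sup>2)"
    "not_mono (a ^ 3 + 1 - a\<^sup>2) (1) (a ^ 3)" "not_mono (2 * a\<^sup>2 - a) (a) (2 * a\<^sup>2)"
    "not_mono (a ^ 3 + a - a\<^sup>2) (a) (a ^ 3)"
    "not_mono (a ^ 3 + a + 1 - 2 * a\<^sup>2) (1) (a ^ 3 - a\<^sup>2)"
    "not_mono (a ^ 3 + a - a\<^sup>2) (a\<^sup>2) (a ^ 3 - a\<^sup>2)"
    "not_mono (a ^ 3 + 2 * a - a\<^sup>2 - 1) (a ^ 3 + 3 * a - 2 * a\<^sup>2 - 1) (a\<^sup>2)"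
    "not_mono (2 * a\<^sup>2 - a) (2 * a - 1) (2 * a\<^sup>2 - a)"
    "not_mono (a ^ 3 + 1 - a) (a\<^sup>2 + 1 - a) (a ^ 3)"
    "not_mono (a ^ 3 + a - a\<^sup>2) (a\<^sup>2 + 1 - a) (a ^ 3 + a - a\<^sup>2)"
    "not_mono (a ^ 3 + 1 - a\<^sup>2) (a\<^sup>2 + 1 - a) (a ^ 3 - a\<^sup>2)"
    "not_mono (a ^ 3 + a - a\<^sup>2) (2 * a\<^sup>2 + 1 - 2 * a) (a ^ 3 + a - 2 * a\<^sup>2)"
    "not_mono (a ^ 3 + 1 - a\<^sup>2) (a ^ 3 + 2 * a - 2 * a\<^sup>2) (a\<^sup>2 - a)"
    "not_mono (a ^ 3 + 2 * a - 2 * a\<^sup>2) (1) (a ^ 3 + a - a\<^sup>2)"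
    "not_mono (a ^ 3) (a ^ 3 + 2 * a - 2 * a\<^sup>2) (2 * a\<^sup>2)"
    "not_mono (2 * a\<^sup>2 + 1 - 2 * a) (2 * a\<^sup>2 + 2 - 3 * a) (a)"
    "not_mono (a ^ 3 + 1 - a) (a ^ 3 + 1 - a\<^sup>2) (a\<^sup>2)"
    "not_mono (a ^ 3) (2 * a\<^sup>2 - a) (a ^ 3 - a\<^sup>2)"
    "not_mono (a ^ 3 + a - 1) (a ^ 3 + 3 * a - 2 * a\<^sup>2 - 1) (2 * a\<^sup>2)"
    "not_mono (a ^ 3 + a) (a\<^sup>2 + a) (a ^ 3)"
    "not_mono (a ^ 3 + 1 - a\<^sup>2) (2 * a\<^sup>2 + 1 - 2 * a) (a ^ 3 - 2 * a\<^sup>2)"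
    "not_mono (a\<^sup>2) (2 * a - 1) (a\<^sup>2 - a)"
    "not_mono (a ^ 3 + 2 * a - 2 * a\<^sup>2) (a\<^sup>2) (a ^ 3 - 2 * a\<^sup>2)"
    "not_mono (a ^ 3 + 2 * a - a\<^sup>2 - 1) (a\<^sup>2) (a ^ 3 + a - a\<^sup>2)"
    "not_mono (a ^ 3 + 2 * a - a\<^sup>2 - 1) (2 * a\<^sup>2 + 1 - 2 * a) (a ^ 3 + 2 * a - 2 * a\<^sup>2)"
    "not_mono (a ^ 3) (a\<^sup>2) (a ^ 3)" "not_mono (2 * a\<^sup>2 + 2 - 3 * a) (1) (2 * a\<^sup>2 - a)"
    "not_mono (a ^ 3 + a) (2 * a\<^sup>2) (a ^ 3 - a\<^sup>2)"
    "not_mono (a ^ 3 + 1 - a) (2 * a\<^sup>2 + 1 - 2 * a) (a ^ 3 - a\<^sup>2)"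
    "not_mono (a ^ 3 + 3 * a - 2 * a\<^sup>2 - 1) (a) (a ^ 3 + a - a\<^sup>2)"
    "not_mono (2 * a\<^sup>2 - a) (a\<^sup>2) (a\<^sup>2)"
    "not_mono (a ^ 3 + a - 1) (a ^ 3 + 2 * a - a\<^sup>2 - 1) (a\<^sup>2)"
    "not_mono (a ^ 3 + 3 * a - 2 * a\<^sup>2 - 1) (2 * a - 1) (a ^ 3 - a\<^sup>2)"
    "not_mono (a ^ 3) (2 * a\<^sup>2 + 1 - 2 * a) (a ^ 3 + a - a\<^sup>2)"
    "not_mono (a ^ 3 - a\<^sup>2) (a\<^sup>2 - a) (a ^ 3 - a\<^sup>2)"
    "not_mono (a ^ 3 + a\<^sup>2 + 1 - 2 * a) (a ^ 3 + 1 - a) (a\<^sup>2)"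
    "not_mono (a ^ 3 + a - 1) (a ^ 3) (a)"
    "not_mono (a ^ 3 - a\<^sup>2) (a ^ 3 + a - 2 * a\<^sup>2) (a\<^sup>2)"
    "not_mono (a ^ 3 + 3 * a - 2 * a\<^sup>2 - 1) (a\<^sup>2 + a - 1) (a ^ 3 - 2 * a\<^sup>2)"
    "not_mono (a ^ 3 + 1 - a) (2 * a\<^sup>2 - a) (a ^ 3 - a\<^sup>2 - a)"
    "not_mono (a ^ 3 + 2 * a - 2 * a\<^sup>2) (2 * a - 1) (a ^ 3 - a\<^sup>2 - a)"
    "not_mono (a ^ 3 + 2 * a - 2 * a\<^sup>2) (a ^ 3 + a + 1 - 2 * a\<^sup>2) (a)"
    "not_mono (a ^ 3 + 1 - a\<^sup>2) (2 * a\<^sup>2 + 2 - 3 * a) (a ^ 3 + a - 2 * a\<^sup>2)"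
    "not_mono (a ^ 3 + 1 - a) (a ^ 3 + 2 * a - 2 * a\<^sup>2) (2 * a\<^sup>2 - a)"
    "not_mono (a ^ 3) (a ^ 3 + 1 - a) (a)"
    "not_mono (2 * a\<^sup>2 + 2 - 3 * a) (a\<^sup>2 + 2 - 2 * a) (a\<^sup>2)"
    "not_mono (a ^ 3 + 3 * a - 2 * a\<^sup>2 - 1) (a\<^sup>2 + 1 - a) (a ^ 3 + 2 * a - 2 * a\<^sup>2)"
    "not_mono (2 * a\<^sup>2) (a\<^sup>2 + a) (a\<^sup>2)"
    "not_mono (a ^ 3 + a - 1) (2 * a\<^sup>2 - a) (a ^ 3 + a - a\<^sup>2)"
    "not_mono (a ^ 3 + 3 * a - 2 * a\<^sup>2 - 1) (a\<^sup>2) (a ^ 3 + a - 2 * a\<^sup>2)"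
    "not_mono (a ^ 3 + 1 - a\<^sup>2) (a\<^sup>2 + 2 - 2 * a) (a ^ 3 + a - a\<^sup>2)"
    "not_mono (a ^ 3 + 2 * a - 2 * a\<^sup>2) (a\<^sup>2 + 1 - a) (a ^ 3 + a - 2 * a\<^sup>2)"
    by ((rule not_monoI, (fact pts)+, algebra)+)
  show False
    using init pts[THEN cover] sols
    unfolding not_mono_def by sat
qed

lemma three_coloring_double:
  fixes a b :: int
  assumes "three_coloring a b (a ^ 3) c r g s" and b: "b \<ge> 1" "a \<ge> b + 2"
    and init: "c (a\<^sup>2) = r" "c (2 * a\<^sup>2) = g"
  shows False
proof -
  interpret three_coloring a b "a ^ 3" c r g s
    by fact
  \<comment> \<open>The admissible parameters form the quadrant with coordinates
    \<open>a - b - 2\<close> and \<open>b - 1\<close>. All products of these up to degree three,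
    once expanded, serve as linear facts about the monomials in \<open>a\<close> and
    \<open>b\<close>.\<close>
  have "0 \<le> a - b - 2" "0 \<le> b - 1"
    using b by simp_all
  then have
    "0 \<le> (a - b - 2)" "0 \<le> (b - 1)" "0 \<le> (a - b - 2) * (a - b - 2)"
    "0 \<le> (a - b - 2) * (b - 1)" "0 \<le> (b - 1) * (b - 1)"
    "0 \<le> (a - b - 2) * (a - b - 2) * (a - b - 2)" "0 \<le> (a - b - 2) * (a - b - 2) * (b - 1)"
    "0 \<le> (a - b - 2) * (b - 1) * (b - 1)" "0 \<le> (b - 1) * (b - 1) * (b - 1)"
    by (simp_all only: mult_nonneg_nonneg)
  then have nl:
    "0 \<le> a - b - 2" "0 \<le> b - 1" "0 \<le> b\<^sup>2 + a\<^sup>2 + 4 * b + 4 - 2 * a * b - 4 * a"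
    "0 \<le> a * b + 2 - b\<^sup>2 - b - a" "0 \<le> b\<^sup>2 + 1 - 2 * b"
    "0 \<le> 3 * a * b\<^sup>2 + a ^ 3 + 12 * a * b + 12 * a - b ^ 3 - 3 * a\<^sup>2 * b - 6 * b\<^sup>2 - 6 * a\<^sup>2 - 12 * b - 8"
    "0 \<le> b ^ 3 + a\<^sup>2 * b + 3 * b\<^sup>2 + 4 * a - 2 * a * b\<^sup>2 - 2 * a * b - a\<^sup>2 - 4"
    "0 \<le> a * b\<^sup>2 + 3 * b + a - b ^ 3 - 2 * a * b - 2" "0 \<le> b ^ 3 + 3 * b - 3 * b\<^sup>2 - 1"
    by (simp_all add: algebra_simps power2_eq_square power3_eq_cube)
  have pts:
    "a\<^sup>2 \<in> {1..a ^ 3}" "a * b \<in> {1..a ^ 3}" "2 * a\<^sup>2 \<in> {1..a ^ 3}"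
    "a\<^sup>2 + a * b \<in> {1..a ^ 3}" "a\<^sup>2 + b\<^sup>2 \<in> {1..a ^ 3}"
    "a\<^sup>2 + 2 * a * b \<in> {1..a ^ 3}" "a\<^sup>2 + 2 * b\<^sup>2 \<in> {1..a ^ 3}"
    "a\<^sup>2 + 3 * a * b \<in> {1..a ^ 3}" "a\<^sup>2 - a * b \<in> {1..a ^ 3}"
    "a\<^sup>2 - b\<^sup>2 \<in> {1..a ^ 3}" "2 * a\<^sup>2 + a * b \<in> {1..a ^ 3}"
    "2 * a\<^sup>2 + 2 * a * b \<in> {1..a ^ 3}" "2 * a\<^sup>2 + 3 * a * b \<in> {1..a ^ 3}"
    "2 * a\<^sup>2 - a * b \<in> {1..a ^ 3}" "2 * a\<^sup>2 - b\<^sup>2 \<in> {1..a ^ 3}"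
    "2 * a\<^sup>2 - 2 * b\<^sup>2 \<in> {1..a ^ 3}" "a\<^sup>2 + a * b + b\<^sup>2 \<in> {1..a ^ 3}"
    "a\<^sup>2 + a * b + 2 * b\<^sup>2 \<in> {1..a ^ 3}" "a\<^sup>2 + a * b + 3 * b\<^sup>2 \<in> {1..a ^ 3}"
    "a\<^sup>2 + 2 * a * b + b\<^sup>2 \<in> {1..a ^ 3}"
    "a\<^sup>2 + 2 * a * b + 2 * b\<^sup>2 \<in> {1..a ^ 3}"
    "a\<^sup>2 + 3 * a * b + b\<^sup>2 \<in> {1..a ^ 3}" "a\<^sup>2 + b\<^sup>2 - a * b \<in> {1..a ^ 3}"
    "a\<^sup>2 + 2 * b\<^sup>2 - a * b \<in> {1..a ^ 3}" "a\<^sup>2 + b\<^sup>2 - 2 * a * b \<in> {1..a ^ 3}"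
    "2 * a\<^sup>2 + a * b + b\<^sup>2 \<in> {1..a ^ 3}"
    "2 * a\<^sup>2 + a * b + 2 * b\<^sup>2 \<in> {1..a ^ 3}"
    "2 * a\<^sup>2 + a * b - b\<^sup>2 \<in> {1..a ^ 3}"
    "2 * a\<^sup>2 + 2 * a * b + b\<^sup>2 \<in> {1..a ^ 3}"
    by (rule atLeastAtMost_iff[THEN iffD2, OF conjI]; ((insert nl(1-5); linarith) | (insert nl; linarith)))+
  have sols:
    "not_mono (a\<^sup>2 + a * b + b\<^sup>2) (a\<^sup>2 + a * b) (a * b)"
    "not_mono (2 * a\<^sup>2 + a * b) (2 * a\<^sup>2 - 2 * b\<^sup>2) (a\<^sup>2 + 2 * a * b)"
    "not_mono (a\<^sup>2 + 3 * a * b + b\<^sup>2) (a\<^sup>2 + 2 * a * b + b\<^sup>2) (a\<^sup>2)"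
    "not_mono (2 * a\<^sup>2 + a * b + 2 * b\<^sup>2) (2 * a\<^sup>2 - b\<^sup>2) (a\<^sup>2 + 3 * a * b)"
    "not_mono (a\<^sup>2 + 3 * a * b + b\<^sup>2) (a\<^sup>2 + a * b) (2 * a\<^sup>2 + a * b)"
    "not_mono (2 * a\<^sup>2 + 2 * a * b + b\<^sup>2) (2 * a\<^sup>2 + 2 * a * b) (a * b)"
    "not_mono (2 * a\<^sup>2 + 3 * a * b) (2 * a\<^sup>2 + 2 * a * b + b\<^sup>2) (a\<^sup>2 - a * b)"
    "not_mono (a\<^sup>2 + 2 * b\<^sup>2 - a * b) (a\<^sup>2 + b\<^sup>2 - a * b) (a * b)"
    "not_mono (a\<^sup>2 + 2 * a * b + 2 * b\<^sup>2) (a\<^sup>2 + a * b + b\<^sup>2) (a\<^sup>2 + a * b)"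
    "not_mono (a\<^sup>2 + 2 * b\<^sup>2) (a\<^sup>2 + b\<^sup>2 - a * b) (a\<^sup>2 + a * b)"
    "not_mono (2 * a\<^sup>2 + 2 * a * b) (2 * a\<^sup>2 + a * b + b\<^sup>2) (a\<^sup>2 - a * b)"
    "not_mono (2 * a\<^sup>2 + 2 * a * b + b\<^sup>2) (2 * a\<^sup>2 + a * b + 2 * b\<^sup>2) (a\<^sup>2 - a * b)"
    "not_mono (2 * a\<^sup>2 + a * b - b\<^sup>2) (2 * a\<^sup>2 - a * b) (2 * a\<^sup>2 - a * b)"
    "not_mono (a\<^sup>2 + 2 * a * b + b\<^sup>2) (a\<^sup>2 + a * b) (a\<^sup>2 + a * b)"
    "not_mono (a\<^sup>2 + 3 * a * b + b\<^sup>2) (a\<^sup>2 + a * b + b\<^sup>2) (2 * a\<^sup>2)"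
    "not_mono (a\<^sup>2 + b\<^sup>2) (a\<^sup>2 + 2 * b\<^sup>2 - a * b) (a\<^sup>2 - a * b)"
    "not_mono (a\<^sup>2 + 2 * b\<^sup>2) (a\<^sup>2 + 2 * b\<^sup>2 - a * b) (a\<^sup>2)"
    "not_mono (a\<^sup>2 + a * b + 2 * b\<^sup>2) (a\<^sup>2 + b\<^sup>2 - a * b) (2 * a\<^sup>2 + a * b)"
    "not_mono (a\<^sup>2 + a * b + 2 * b\<^sup>2) (a\<^sup>2 + 2 * b\<^sup>2) (a\<^sup>2)"
    "not_mono (2 * a\<^sup>2 + 3 * a * b) (2 * a\<^sup>2 + a * b + b\<^sup>2) (2 * a\<^sup>2 - a * b)"
    "not_mono (a\<^sup>2 + b\<^sup>2 - a * b) (a\<^sup>2 + b\<^sup>2 - 2 * a * b) (a\<^sup>2)"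
    "not_mono (2 * a\<^sup>2 + 2 * a * b + b\<^sup>2) (2 * a\<^sup>2 - 2 * b\<^sup>2) (2 * a\<^sup>2 + 3 * a * b)"
    "not_mono (a\<^sup>2 + 2 * b\<^sup>2) (a\<^sup>2 - a * b) (a\<^sup>2 + 2 * a * b)"
    "not_mono (a\<^sup>2 + a * b + 3 * b\<^sup>2) (a\<^sup>2) (a\<^sup>2 + 3 * a * b)"
    "not_mono (a\<^sup>2) (a\<^sup>2 - b\<^sup>2) (a * b)"
    "not_mono (2 * a\<^sup>2) (2 * a\<^sup>2 - b\<^sup>2) (a * b)"
    "not_mono (a\<^sup>2 + 2 * a * b) (a\<^sup>2 - b\<^sup>2) (2 * a\<^sup>2 + a * b)"
    "not_mono (a\<^sup>2 + 2 * a * b) (a\<^sup>2 + a * b + b\<^sup>2) (a\<^sup>2 - a * b)"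
    "not_mono (a\<^sup>2 + 3 * a * b + b\<^sup>2) (a\<^sup>2 + 3 * a * b) (a * b)"
    "not_mono (2 * a\<^sup>2 + 2 * a * b + b\<^sup>2) (2 * a\<^sup>2 - b\<^sup>2) (2 * a\<^sup>2 + 2 * a * b)"
    "not_mono (a\<^sup>2 + a * b) (a\<^sup>2) (a\<^sup>2)"
    "not_mono (a\<^sup>2 + 2 * a * b + b\<^sup>2) (a\<^sup>2 - b\<^sup>2) (2 * a\<^sup>2 + 2 * a * b)"
    "not_mono (2 * a\<^sup>2 + 2 * a * b) (2 * a\<^sup>2) (2 * a\<^sup>2)"
    "not_mono (a\<^sup>2 + 2 * a * b + 2 * b\<^sup>2) (a\<^sup>2 + a * b + 3 * b\<^sup>2) (a\<^sup>2 - a * b)"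
    "not_mono (a\<^sup>2) (a\<^sup>2 - a * b) (a\<^sup>2)"
    "not_mono (a\<^sup>2 - a * b) (a\<^sup>2 + b\<^sup>2 - 2 * a * b) (a\<^sup>2 - a * b)"
    "not_mono (2 * a\<^sup>2 + a * b + b\<^sup>2) (2 * a\<^sup>2) (a\<^sup>2 + a * b)"
    "not_mono (2 * a\<^sup>2 + 2 * a * b + b\<^sup>2) (2 * a\<^sup>2 + a * b - b\<^sup>2) (a\<^sup>2 + 2 * a * b)"
    "not_mono (2 * a\<^sup>2 + a * b - b\<^sup>2) (2 * a\<^sup>2 - b\<^sup>2) (a\<^sup>2)"
    "not_mono (2 * a\<^sup>2 + a * b - b\<^sup>2) (2 * a\<^sup>2) (a\<^sup>2 - a * b)"
    "not_mono (a\<^sup>2 + a * b + b\<^sup>2) (a\<^sup>2 - a * b) (2 * a\<^sup>2 + a * b)"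
    "not_mono (a\<^sup>2 + 2 * a * b + 2 * b\<^sup>2) (a\<^sup>2) (2 * a\<^sup>2 + 2 * a * b)"
    "not_mono (a\<^sup>2 + 2 * a * b + b\<^sup>2) (a\<^sup>2 + b\<^sup>2) (2 * a\<^sup>2)"
    "not_mono (a\<^sup>2 + a * b) (a\<^sup>2 - a * b) (2 * a\<^sup>2)"
    "not_mono (a\<^sup>2 + a * b + 3 * b\<^sup>2) (a\<^sup>2 + 2 * b\<^sup>2) (a\<^sup>2 + a * b)"
    "not_mono (a\<^sup>2 + 2 * a * b + 2 * b\<^sup>2) (a\<^sup>2 + 2 * b\<^sup>2) (2 * a\<^sup>2)"
    "not_mono (a\<^sup>2 + a * b + b\<^sup>2) (a\<^sup>2 + b\<^sup>2 - a * b) (2 * a\<^sup>2)"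
    "not_mono (a\<^sup>2 + a * b + 2 * b\<^sup>2) (a\<^sup>2 + b\<^sup>2) (a\<^sup>2 + a * b)"
    "not_mono (2 * a\<^sup>2 + a * b + b\<^sup>2) (2 * a\<^sup>2 - 2 * b\<^sup>2) (a\<^sup>2 + 3 * a * b)"
    "not_mono (2 * a\<^sup>2 + 2 * a * b) (2 * a\<^sup>2 + a * b) (a\<^sup>2)"
    "not_mono (2 * a\<^sup>2 + 2 * a * b + b\<^sup>2) (2 * a\<^sup>2) (2 * a\<^sup>2 + a * b)"
    "not_mono (2 * a\<^sup>2 + 2 * a * b + b\<^sup>2) (2 * a\<^sup>2 + a * b + b\<^sup>2) (a\<^sup>2)"
    "not_mono (a\<^sup>2 + 3 * a * b) (a\<^sup>2 + 2 * a * b + b\<^sup>2) (a\<^sup>2 - a * b)"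
    "not_mono (a\<^sup>2 + b\<^sup>2) (a\<^sup>2 + b\<^sup>2 - 2 * a * b) (2 * a\<^sup>2)"
    "not_mono (2 * a\<^sup>2 + a * b) (2 * a\<^sup>2 + a * b - b\<^sup>2) (a * b)"
    "not_mono (2 * a\<^sup>2 + 2 * a * b) (2 * a\<^sup>2 - 2 * b\<^sup>2) (2 * a\<^sup>2 + 2 * a * b)"
    "not_mono (2 * a\<^sup>2 + a * b + b\<^sup>2) (2 * a\<^sup>2 + a * b) (a * b)"
    "not_mono (a\<^sup>2 + 2 * b\<^sup>2) (a\<^sup>2 + b\<^sup>2) (a * b)"
    "not_mono (2 * a\<^sup>2 + 3 * a * b) (2 * a\<^sup>2 + a * b) (2 * a\<^sup>2)"
    "not_mono (a\<^sup>2 + 2 * a * b + b\<^sup>2) (a\<^sup>2) (2 * a\<^sup>2 + a * b)"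
    "not_mono (a\<^sup>2 + b\<^sup>2) (a\<^sup>2 + b\<^sup>2 - a * b) (a\<^sup>2)"
    "not_mono (a\<^sup>2 + b\<^sup>2) (a\<^sup>2 - a * b) (a\<^sup>2 + a * b)"
    "not_mono (2 * a\<^sup>2 + a * b) (2 * a\<^sup>2 - a * b) (2 * a\<^sup>2)"
    "not_mono (a\<^sup>2 + a * b) (a\<^sup>2 + b\<^sup>2 - a * b) (2 * a\<^sup>2 - a * b)"
    "not_mono (a\<^sup>2 + a * b + b\<^sup>2) (a\<^sup>2 - b\<^sup>2) (a\<^sup>2 + 2 * a * b)"
    "not_mono (2 * a\<^sup>2 + 3 * a * b) (2 * a\<^sup>2 + 2 * a * b) (a\<^sup>2)"
    "not_mono (2 * a\<^sup>2 + 2 * a * b) (2 * a\<^sup>2 + a * b - b\<^sup>2) (a\<^sup>2 + a * b)"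
    "not_mono (a\<^sup>2 + a * b + 2 * b\<^sup>2) (a\<^sup>2 + a * b + b\<^sup>2) (a * b)"
    "not_mono (a\<^sup>2 + 2 * a * b + b\<^sup>2) (a\<^sup>2 + a * b + b\<^sup>2) (a\<^sup>2)"
    "not_mono (a\<^sup>2 + 3 * a * b) (a\<^sup>2 + a * b) (2 * a\<^sup>2)"
    "not_mono (2 * a\<^sup>2 + 2 * a * b) (2 * a\<^sup>2 - b\<^sup>2) (2 * a\<^sup>2 + a * b)"
    "not_mono (a\<^sup>2 + a * b + 2 * b\<^sup>2) (a\<^sup>2 - a * b) (2 * a\<^sup>2 + 2 * a * b)"
    "not_mono (a\<^sup>2 + a * b) (a\<^sup>2 - b\<^sup>2) (a\<^sup>2 + a * b)"
    "not_mono (a\<^sup>2 + a * b + b\<^sup>2) (a\<^sup>2 + b\<^sup>2) (a\<^sup>2)"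
    "not_mono (a\<^sup>2 + 2 * a * b + 2 * b\<^sup>2) (a\<^sup>2 + 2 * a * b + b\<^sup>2) (a * b)"
    "not_mono (a\<^sup>2 + 2 * a * b) (a\<^sup>2 + b\<^sup>2) (2 * a\<^sup>2 - a * b)"
    "not_mono (a\<^sup>2 + 2 * a * b + 2 * b\<^sup>2) (a\<^sup>2 - b\<^sup>2) (2 * a\<^sup>2 + 3 * a * b)"
    "not_mono (a\<^sup>2 + 2 * a * b + b\<^sup>2) (a\<^sup>2 + a * b + 2 * b\<^sup>2) (a\<^sup>2 - a * b)"
    "not_mono (2 * a\<^sup>2 + a * b + 2 * b\<^sup>2) (2 * a\<^sup>2) (a\<^sup>2 + 2 * a * b)"
    "not_mono (a\<^sup>2 - b\<^sup>2) (a\<^sup>2 - a * b) (a\<^sup>2 - a * b)"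
    "not_mono (a\<^sup>2 + 2 * a * b + b\<^sup>2) (a\<^sup>2 + 2 * b\<^sup>2) (2 * a\<^sup>2 - a * b)"
    "not_mono (a\<^sup>2 + a * b + 3 * b\<^sup>2) (a\<^sup>2 + a * b + 2 * b\<^sup>2) (a * b)"
    "not_mono (a\<^sup>2 + a * b + b\<^sup>2) (a\<^sup>2 + 2 * b\<^sup>2 - a * b) (2 * a\<^sup>2 - a * b)"
    "not_mono (a\<^sup>2 + a * b + 3 * b\<^sup>2) (a\<^sup>2 - a * b) (2 * a\<^sup>2 + 3 * a * b)"
    "not_mono (a\<^sup>2 + 2 * a * b + b\<^sup>2) (a\<^sup>2 + 2 * a * b) (a * b)"
    "not_mono (a\<^sup>2 + 2 * a * b + 2 * b\<^sup>2) (a\<^sup>2 + b\<^sup>2) (2 * a\<^sup>2 + a * b)"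
    "not_mono (a\<^sup>2 + b\<^sup>2) (a\<^sup>2) (a * b)"
    "not_mono (a\<^sup>2 + a * b + 2 * b\<^sup>2) (a\<^sup>2 - b\<^sup>2) (a\<^sup>2 + 3 * a * b)"
    "not_mono (a\<^sup>2 + b\<^sup>2 - a * b) (a\<^sup>2 - a * b) (a * b)"
    "not_mono (a\<^sup>2 + 2 * a * b + 2 * b\<^sup>2) (a\<^sup>2 + a * b) (a\<^sup>2 + 2 * a * b)"
    "not_mono (a\<^sup>2 + a * b + 2 * b\<^sup>2) (a\<^sup>2 + 2 * b\<^sup>2 - a * b) (2 * a\<^sup>2)"
    "not_mono (a\<^sup>2 + 2 * a * b + 2 * b\<^sup>2) (a\<^sup>2 + a * b + 2 * b\<^sup>2) (a\<^sup>2)"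
    by ((rule not_monoI, (fact pts)+, algebra)+)
  show False
    using init pts[THEN cover] sols
    unfolding not_mono_def by sat
qed

lemma three_coloring_step:
  fixes a b j :: int
  assumes "three_coloring a b (a ^ 3) c r g s" and b: "b \<ge> 1" "a \<ge> b + 2" and j: "j \<ge> 3" "j \<le> a"
    and init: "c (a\<^sup>2) = r" "c (2 * a\<^sup>2) = r" "c (j * a\<^sup>2 - a\<^sup>2) = r" "c (j * a\<^sup>2 - 2 * a\<^sup>2) = r"
      "c (j * a\<^sup>2) = g"
  shows False
proof -
  interpret three_coloring a b "a ^ 3" c r g s
    by fact
  \<comment> \<open>The bounds \<open>3 \<le> j \<le> a\<close> contribute the further coordinates
    \<open>j - 3\<close> and \<open>a - j\<close>. The points have degree at most one in
    \<open>j\<close>, so each of these is multiplied only by products in \<open>a\<close> and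
    \<open>b\<close>; the monomial \<open>a ^ 3\<close> comes from the factor
    \<open>a - j\<close>.\<close>
  have "0 \<le> a - b - 2" "0 \<le> b - 1" "0 \<le> j - 3" "0 \<le> a - j"
    using b j by simp_all
  then have
    "0 \<le> (a - b - 2)" "0 \<le> (b - 1)" "0 \<le> (a - b - 2) * (a - b - 2)"
    "0 \<le> (a - b - 2) * (b - 1)" "0 \<le> (b - 1) * (b - 1)" "0 \<le> (j - 3)"
    "0 \<le> (j - 3) * (a - b - 2)" "0 \<le> (j - 3) * (b - 1)" "0 \<le> (j - 3) * (a - b - 2) * (a - b - 2)"
    "0 \<le> (j - 3) * (a - b - 2) * (b - 1)" "0 \<le> (j - 3) * (b - 1) * (b - 1)" "0 \<le> (a - j)"
    "0 \<le> (a - j) * (a - b - 2)" "0 \<le> (a - j) * (b - 1)" "0 \<le> (a - j) * (a - b - 2) * (a - b - 2)"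
    "0 \<le> (a - j) * (a - b - 2) * (b - 1)" "0 \<le> (a - j) * (b - 1) * (b - 1)"
    by (simp_all only: mult_nonneg_nonneg)
  then have nl:
    "0 \<le> a - b - 2" "0 \<le> b - 1" "0 \<le> b\<^sup>2 + a\<^sup>2 + 4 * b + 4 - 2 * a * b - 4 * a"
    "0 \<le> a * b + 2 - b\<^sup>2 - b - a" "0 \<le> b\<^sup>2 + 1 - 2 * b" "0 \<le> j - 3"
    "0 \<le> j * a + 3 * b + 6 - j * b - 2 * j - 3 * a" "0 \<le> j * b + 3 - j - 3 * b"
    "0 \<le> j * b\<^sup>2 + j * a\<^sup>2 + 4 * j * b + 6 * a * b + 4 * j + 12 * a - 2 * j * a * b - 3 * b\<^sup>2 - 4 * j * a - 3 * a\<^sup>2 - 12 * b - 12"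
    "0 \<le> j * a * b + 3 * b\<^sup>2 + 2 * j + 3 * b + 3 * a - j * b\<^sup>2 - j * b - j * a - 3 * a * b - 6"
    "0 \<le> j * b\<^sup>2 + j + 6 * b - 2 * j * b - 3 * b\<^sup>2 - 3" "0 \<le> a - j"
    "0 \<le> j * b + a\<^sup>2 + 2 * j - j * a - a * b - 2 * a" "0 \<le> a * b + j - j * b - a"
    "0 \<le> 2 * j * a * b + a * b\<^sup>2 + a ^ 3 + 4 * j * a + 4 * a * b + 4 * a - j * b\<^sup>2 - j * a\<^sup>2 - 2 * a\<^sup>2 * b - 4 * j * b - 4 * a\<^sup>2 - 4 * j"
    "0 \<le> j * b\<^sup>2 + a\<^sup>2 * b + j * b + j * a + 2 * a - j * a * b - a * b\<^sup>2 - a * b - a\<^sup>2 - 2 * j"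
    "0 \<le> a * b\<^sup>2 + 2 * j * b + a - j * b\<^sup>2 - 2 * a * b - j"
    by (simp_all add: algebra_simps power2_eq_square power3_eq_cube)
  \<comment> \<open>This is where \<open>a \<ge> b + 2\<close> becomes delicate. At
    \<open>j = a\<close> and \<open>b = a - 2\<close>, the point
    \<open>a ^ 2 + 2 * a * b + j * a * b - b ^ 2\<close> is \<open>a ^ 3 - 4\<close>, whereas at
    \<open>j = a\<close> and \<open>b = a - 1\<close> the point
    \<open>2 * a ^ 2 + j * a * b - b ^ 2\<close> would be \<open>a ^ 3 + 2 * a - 1\<close>.\<close>
  have pts:
    "a\<^sup>2 \<in> {1..a ^ 3}" "a * b \<in> {1..a ^ 3}" "2 * a\<^sup>2 \<in> {1..a ^ 3}"
    "j * a\<^sup>2 \<in> {1..a ^ 3}" "a\<^sup>2 + a * b \<in> {1..a ^ 3}"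
    "a\<^sup>2 + b\<^sup>2 \<in> {1..a ^ 3}" "a\<^sup>2 + 2 * a * b \<in> {1..a ^ 3}"
    "a\<^sup>2 + 2 * b\<^sup>2 \<in> {1..a ^ 3}" "a\<^sup>2 - a * b \<in> {1..a ^ 3}"
    "a\<^sup>2 - b\<^sup>2 \<in> {1..a ^ 3}" "2 * a\<^sup>2 + a * b \<in> {1..a ^ 3}"
    "2 * a\<^sup>2 + b\<^sup>2 \<in> {1..a ^ 3}" "2 * a\<^sup>2 + 2 * a * b \<in> {1..a ^ 3}"
    "2 * a\<^sup>2 - a * b \<in> {1..a ^ 3}" "2 * a\<^sup>2 - b\<^sup>2 \<in> {1..a ^ 3}"
    "2 * a\<^sup>2 - 2 * a * b \<in> {1..a ^ 3}" "a\<^sup>2 + j * a * b \<in> {1..a ^ 3}"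
    "a\<^sup>2 + j * b\<^sup>2 \<in> {1..a ^ 3}" "j * a\<^sup>2 - a\<^sup>2 \<in> {1..a ^ 3}"
    "j * a\<^sup>2 - a * b \<in> {1..a ^ 3}" "j * a\<^sup>2 - 2 * a\<^sup>2 \<in> {1..a ^ 3}"
    "a\<^sup>2 + a * b + b\<^sup>2 \<in> {1..a ^ 3}" "a\<^sup>2 + a * b - b\<^sup>2 \<in> {1..a ^ 3}"
    "a\<^sup>2 + 2 * a * b + b\<^sup>2 \<in> {1..a ^ 3}"
    "a\<^sup>2 + 2 * a * b + 2 * b\<^sup>2 \<in> {1..a ^ 3}"
    "a\<^sup>2 + 2 * a * b - b\<^sup>2 \<in> {1..a ^ 3}" "a\<^sup>2 + b\<^sup>2 - a * b \<in> {1..a ^ 3}"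
    "a\<^sup>2 + b\<^sup>2 - 2 * a * b \<in> {1..a ^ 3}" "2 * a\<^sup>2 + a * b + b\<^sup>2 \<in> {1..a ^ 3}"
    "2 * a\<^sup>2 + a * b - b\<^sup>2 \<in> {1..a ^ 3}" "2 * a\<^sup>2 - a * b - b\<^sup>2 \<in> {1..a ^ 3}"
    "a\<^sup>2 + a * b + j * a * b \<in> {1..a ^ 3}" "a\<^sup>2 + a * b + j * b\<^sup>2 \<in> {1..a ^ 3}"
    "a\<^sup>2 + b\<^sup>2 + j * a * b \<in> {1..a ^ 3}"
    "a\<^sup>2 + 2 * a * b + j * b\<^sup>2 \<in> {1..a ^ 3}" "a\<^sup>2 + j * a * b - a * b \<in> {1..a ^ 3}"
    "a\<^sup>2 + j * b\<^sup>2 - b\<^sup>2 \<in> {1..a ^ 3}"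
    "a\<^sup>2 + j * a * b - 2 * a * b \<in> {1..a ^ 3}"
    "a\<^sup>2 + j * a * b - 2 * b\<^sup>2 \<in> {1..a ^ 3}"
    "2 * a\<^sup>2 + j * a * b - a * b \<in> {1..a ^ 3}"
    "2 * a\<^sup>2 + j * a * b - b\<^sup>2 \<in> {1..a ^ 3}"
    "2 * a\<^sup>2 + j * a * b - 2 * a * b \<in> {1..a ^ 3}"
    "a * b + j * a\<^sup>2 - a\<^sup>2 \<in> {1..a ^ 3}" "j * a\<^sup>2 - a\<^sup>2 - a * b \<in> {1..a ^ 3}"
    "a * b + j * a\<^sup>2 - 2 * a\<^sup>2 \<in> {1..a ^ 3}"
    "j * a\<^sup>2 - 2 * a\<^sup>2 - a * b \<in> {1..a ^ 3}"
    "a\<^sup>2 + a * b + j * a * b - b\<^sup>2 \<in> {1..a ^ 3}"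
    "a\<^sup>2 + a * b + j * b\<^sup>2 - b\<^sup>2 \<in> {1..a ^ 3}"
    "a\<^sup>2 + 2 * a * b + j * a * b - b\<^sup>2 \<in> {1..a ^ 3}"
    "a\<^sup>2 + 2 * a * b + j * b\<^sup>2 - b\<^sup>2 \<in> {1..a ^ 3}"
    "a\<^sup>2 + b\<^sup>2 + j * a * b - a * b \<in> {1..a ^ 3}"
    "a\<^sup>2 + j * a * b - a * b - b\<^sup>2 \<in> {1..a ^ 3}"
    "a\<^sup>2 + b\<^sup>2 + j * a * b - 2 * a * b \<in> {1..a ^ 3}"
    "a\<^sup>2 + j * a * b - 2 * a * b - b\<^sup>2 \<in> {1..a ^ 3}"
    "a * b + j * a\<^sup>2 - a\<^sup>2 - j * a * b \<in> {1..a ^ 3}"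
    by (rule atLeastAtMost_iff[THEN iffD2, OF conjI]; insert nl; linarith)+
  have sols:
    "not_mono (a\<^sup>2 + j * a * b) (a\<^sup>2 + j * a * b - a * b - b\<^sup>2) (a\<^sup>2 + a * b)"
    "not_mono (a\<^sup>2 + b\<^sup>2 + j * a * b - 2 * a * b) (a\<^sup>2 + b\<^sup>2 - a * b) (j * a\<^sup>2 - a\<^sup>2)"
    "not_mono (a\<^sup>2 + j * a * b - 2 * a * b) (a\<^sup>2) (j * a\<^sup>2 - 2 * a\<^sup>2)"
    "not_mono (a\<^sup>2 + 2 * b\<^sup>2) (a\<^sup>2 + b\<^sup>2) (a * b)"
    "not_mono (2 * a\<^sup>2) (2 * a\<^sup>2 - 2 * a * b) (2 * a\<^sup>2)"
    "not_mono (a\<^sup>2 + a * b + j * a * b) (a\<^sup>2 + j * a * b) (a\<^sup>2)"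
    "not_mono (a\<^sup>2 + 2 * a * b - b\<^sup>2) (a\<^sup>2 - b\<^sup>2) (2 * a\<^sup>2)"
    "not_mono (2 * a\<^sup>2 + j * a * b - a * b) (2 * a\<^sup>2 - a * b) (j * a\<^sup>2)"
    "not_mono (a\<^sup>2 + a * b + j * b\<^sup>2) (a\<^sup>2 + j * b\<^sup>2) (a\<^sup>2)"
    "not_mono (2 * a\<^sup>2 + 2 * a * b) (2 * a\<^sup>2 + b\<^sup>2) (2 * a\<^sup>2 - a * b)"
    "not_mono (a\<^sup>2 + j * a * b - 2 * b\<^sup>2) (a\<^sup>2 + j * a * b - 2 * a * b) (2 * a\<^sup>2 - 2 * a * b)"
    "not_mono (a\<^sup>2 + 2 * a * b + b\<^sup>2) (a\<^sup>2 + b\<^sup>2) (2 * a\<^sup>2)"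
    "not_mono (2 * a\<^sup>2 + a * b - b\<^sup>2) (2 * a\<^sup>2 - a * b) (2 * a\<^sup>2 - a * b)"
    "not_mono (a\<^sup>2 + j * a * b) (a\<^sup>2 + a * b - b\<^sup>2) (a * b + j * a\<^sup>2 - a\<^sup>2)"
    "not_mono (a\<^sup>2 + 2 * a * b + 2 * b\<^sup>2) (a\<^sup>2 + b\<^sup>2) (2 * a\<^sup>2 + a * b)"
    "not_mono (2 * a\<^sup>2 + 2 * a * b) (2 * a\<^sup>2 + a * b - b\<^sup>2) (a\<^sup>2 + a * b)"
    "not_mono (a\<^sup>2 + 2 * a * b + b\<^sup>2) (a\<^sup>2 + a * b) (a\<^sup>2 + a * b)"
    "not_mono (a\<^sup>2 + 2 * a * b + j * b\<^sup>2 - b\<^sup>2) (a\<^sup>2 + j * b\<^sup>2) (2 * a\<^sup>2 - a * b)"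
    "not_mono (a\<^sup>2 + a * b) (a\<^sup>2) (a\<^sup>2)"
    "not_mono (a\<^sup>2 + j * b\<^sup>2) (a\<^sup>2 + b\<^sup>2 - 2 * a * b) (2 * a\<^sup>2 + j * a * b - a * b)"
    "not_mono (a\<^sup>2 + b\<^sup>2 - a * b) (a\<^sup>2 + b\<^sup>2 - 2 * a * b) (a\<^sup>2)"
    "not_mono (a\<^sup>2 + b\<^sup>2) (a\<^sup>2 - a * b) (a\<^sup>2 + a * b)"
    "not_mono (a\<^sup>2 + b\<^sup>2 + j * a * b - a * b) (a\<^sup>2 + b\<^sup>2) (j * a\<^sup>2 - a\<^sup>2)"
    "not_mono (a\<^sup>2 + 2 * a * b + j * b\<^sup>2) (a\<^sup>2 + a * b + b\<^sup>2) (a\<^sup>2 + j * a * b - a * b)"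
    "not_mono (a\<^sup>2 + b\<^sup>2 + j * a * b) (a\<^sup>2 + j * a * b) (a * b)"
    "not_mono (a\<^sup>2 + j * a * b - a * b) (a\<^sup>2 + j * b\<^sup>2 - b\<^sup>2) (a * b + j * a\<^sup>2 - a\<^sup>2 - j * a * b)"
    "not_mono (a\<^sup>2 + j * a * b - a * b) (a\<^sup>2 + j * a * b - a * b - b\<^sup>2) (a * b)"
    "not_mono (a\<^sup>2 + 2 * a * b + j * a * b - b\<^sup>2) (a\<^sup>2 + a * b + j * a * b - b\<^sup>2) (a\<^sup>2)"
    "not_mono (a\<^sup>2 + a * b + b\<^sup>2) (a\<^sup>2 + a * b) (a * b)"
    "not_mono (a\<^sup>2 + 2 * b\<^sup>2) (a\<^sup>2 + b\<^sup>2 - 2 * a * b) (2 * a\<^sup>2 + a * b)"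
    "not_mono (a\<^sup>2 + a * b + j * b\<^sup>2) (a\<^sup>2 + a * b + j * b\<^sup>2 - b\<^sup>2) (a * b)"
    "not_mono (j * a\<^sup>2 - a\<^sup>2) (a * b + j * a\<^sup>2 - a\<^sup>2 - j * a * b) (j * a\<^sup>2 - a\<^sup>2)"
    "not_mono (2 * a\<^sup>2 + j * a * b - b\<^sup>2) (2 * a\<^sup>2 + a * b) (j * a\<^sup>2 - a\<^sup>2 - a * b)"
    "not_mono (a\<^sup>2 + 2 * a * b + 2 * b\<^sup>2) (a\<^sup>2 + a * b) (a\<^sup>2 + 2 * a * b)"
    "not_mono (a\<^sup>2 + j * a * b - a * b) (a\<^sup>2 + b\<^sup>2 + j * a * b - 2 * a * b) (a\<^sup>2 - a * b)"
    "not_mono (a\<^sup>2 + b\<^sup>2) (a\<^sup>2 + b\<^sup>2 - a * b) (a\<^sup>2)"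
    "not_mono (a\<^sup>2 + a * b + j * b\<^sup>2) (a\<^sup>2 + b\<^sup>2 - a * b) (2 * a\<^sup>2 + j * a * b - a * b)"
    "not_mono (a\<^sup>2 + 2 * a * b + j * b\<^sup>2 - b\<^sup>2) (a\<^sup>2 + j * b\<^sup>2 - b\<^sup>2) (2 * a\<^sup>2)"
    "not_mono (a * b + j * a\<^sup>2 - a\<^sup>2) (j * a\<^sup>2 - a\<^sup>2) (a\<^sup>2)"
    "not_mono (a\<^sup>2 + 2 * a * b - b\<^sup>2) (a\<^sup>2 + b\<^sup>2) (2 * a\<^sup>2 - 2 * a * b)"
    "not_mono (a\<^sup>2 + 2 * a * b + j * b\<^sup>2 - b\<^sup>2) (a\<^sup>2 + a * b) (a\<^sup>2 + j * a * b - a * b)"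
    "not_mono (a\<^sup>2 + 2 * b\<^sup>2) (a\<^sup>2 - a * b) (a\<^sup>2 + 2 * a * b)"
    "not_mono (a\<^sup>2 + 2 * a * b + 2 * b\<^sup>2) (a\<^sup>2 + 2 * a * b + b\<^sup>2) (a * b)"
    "not_mono (2 * a\<^sup>2 + j * a * b - b\<^sup>2) (2 * a\<^sup>2 + 2 * a * b) (j * a\<^sup>2 - 2 * a\<^sup>2 - a * b)"
    "not_mono (2 * a\<^sup>2 + a * b - b\<^sup>2) (2 * a\<^sup>2 - a * b - b\<^sup>2) (2 * a\<^sup>2)"
    "not_mono (a\<^sup>2 + a * b + j * b\<^sup>2 - b\<^sup>2) (a\<^sup>2 + j * b\<^sup>2) (a\<^sup>2 - a * b)"
    "not_mono (2 * a\<^sup>2 + j * a * b - 2 * a * b) (2 * a\<^sup>2 - a * b - b\<^sup>2) (a * b + j * a\<^sup>2 - a\<^sup>2)"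
    "not_mono (a\<^sup>2 + b\<^sup>2 + j * a * b) (a\<^sup>2 + b\<^sup>2 + j * a * b - a * b) (a\<^sup>2)"
    "not_mono (a\<^sup>2 + 2 * a * b + j * b\<^sup>2) (a\<^sup>2 + b\<^sup>2) (2 * a\<^sup>2 + j * a * b - a * b)"
    "not_mono (a\<^sup>2 + 2 * a * b + 2 * b\<^sup>2) (a\<^sup>2 + 2 * b\<^sup>2) (2 * a\<^sup>2)"
    "not_mono (2 * a\<^sup>2 + a * b) (2 * a\<^sup>2) (a\<^sup>2)"
    "not_mono (2 * a\<^sup>2 + 2 * a * b) (2 * a\<^sup>2) (2 * a\<^sup>2)"
    "not_mono (a\<^sup>2 + 2 * a * b + j * a * b - b\<^sup>2) (a\<^sup>2 + 2 * a * b - b\<^sup>2) (j * a\<^sup>2)"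
    "not_mono (a\<^sup>2 + a * b + j * a * b) (a\<^sup>2 + a * b + j * a * b - b\<^sup>2) (a * b)"
    "not_mono (a\<^sup>2 - b\<^sup>2) (a\<^sup>2 - a * b) (a\<^sup>2 - a * b)"
    "not_mono (a\<^sup>2 + j * a * b - a * b - b\<^sup>2) (a\<^sup>2 + j * a * b - 2 * a * b) (a\<^sup>2 - a * b)"
    "not_mono (a\<^sup>2 + 2 * a * b + j * b\<^sup>2 - b\<^sup>2) (a\<^sup>2 + a * b + j * b\<^sup>2) (a\<^sup>2 - a * b)"
    "not_mono (a\<^sup>2 + a * b + j * a * b) (a\<^sup>2 + 2 * a * b - b\<^sup>2) (a * b + j * a\<^sup>2 - a\<^sup>2)"
    "not_mono (a\<^sup>2 + a * b + j * b\<^sup>2 - b\<^sup>2) (a\<^sup>2 + j * b\<^sup>2 - b\<^sup>2) (a\<^sup>2)"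
    "not_mono (a\<^sup>2 + j * a * b - a * b) (a\<^sup>2) (j * a\<^sup>2 - a\<^sup>2)"
    "not_mono (a\<^sup>2 + j * a * b - 2 * a * b - b\<^sup>2) (a\<^sup>2 - a * b) (j * a\<^sup>2 - a\<^sup>2 - a * b)"
    "not_mono (a\<^sup>2 + b\<^sup>2 + j * a * b - a * b) (a\<^sup>2 + j * a * b - 2 * a * b) (a\<^sup>2 + a * b)"
    "not_mono (a\<^sup>2 + j * a * b - a * b) (a\<^sup>2 + b\<^sup>2) (j * a\<^sup>2 - a\<^sup>2 - a * b)"
    "not_mono (a\<^sup>2 + 2 * a * b + j * b\<^sup>2 - b\<^sup>2) (a\<^sup>2 + a * b + j * b\<^sup>2 - b\<^sup>2) (a\<^sup>2)"
    "not_mono (a\<^sup>2 + j * a * b - 2 * a * b - b\<^sup>2) (a\<^sup>2 - b\<^sup>2) (j * a\<^sup>2 - 2 * a\<^sup>2)"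
    "not_mono (2 * a\<^sup>2 + a * b) (2 * a\<^sup>2 + b\<^sup>2) (a\<^sup>2 - a * b)"
    "not_mono (a\<^sup>2 + b\<^sup>2 + j * a * b) (a\<^sup>2 + a * b) (a * b + j * a\<^sup>2 - a\<^sup>2)"
    "not_mono (a\<^sup>2 + a * b + j * b\<^sup>2) (a\<^sup>2 + b\<^sup>2) (a\<^sup>2 + j * a * b - a * b)"
    "not_mono (a\<^sup>2 + j * a * b - 2 * a * b) (a\<^sup>2 - b\<^sup>2) (a * b + j * a\<^sup>2 - 2 * a\<^sup>2)"
    "not_mono (a\<^sup>2 + j * a * b - a * b) (a\<^sup>2 + j * a * b - 2 * a * b - b\<^sup>2) (a\<^sup>2 + a * b)"
    "not_mono (2 * a\<^sup>2) (2 * a\<^sup>2 - a * b) (a\<^sup>2)"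
    "not_mono (2 * a\<^sup>2 + j * a * b - b\<^sup>2) (2 * a\<^sup>2 + j * a * b - 2 * a * b) (2 * a\<^sup>2 - a * b)"
    "not_mono (a\<^sup>2 + 2 * a * b + b\<^sup>2) (a\<^sup>2 - b\<^sup>2) (2 * a\<^sup>2 + 2 * a * b)"
    "not_mono (2 * a\<^sup>2 + a * b - b\<^sup>2) (2 * a\<^sup>2 - b\<^sup>2) (a\<^sup>2)"
    "not_mono (a\<^sup>2 + 2 * a * b + b\<^sup>2) (a\<^sup>2 + 2 * a * b) (a * b)"
    "not_mono (a\<^sup>2 + b\<^sup>2) (a\<^sup>2 + b\<^sup>2 - 2 * a * b) (2 * a\<^sup>2)"
    "not_mono (a\<^sup>2 - a * b) (a\<^sup>2 + b\<^sup>2 - 2 * a * b) (a\<^sup>2 - a * b)"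
    "not_mono (a\<^sup>2 + j * a * b - 2 * a * b) (a\<^sup>2 + b\<^sup>2 - 2 * a * b) (j * a\<^sup>2 - a * b)"
    "not_mono (a\<^sup>2) (a\<^sup>2 - b\<^sup>2) (a * b)"
    "not_mono (a\<^sup>2 + a * b + j * b\<^sup>2) (a\<^sup>2) (a\<^sup>2 + j * a * b)"
    "not_mono (2 * a\<^sup>2 - b\<^sup>2) (2 * a\<^sup>2 - 2 * a * b) (2 * a\<^sup>2 - a * b)"
    "not_mono (a\<^sup>2 + a * b) (a\<^sup>2 + b\<^sup>2 - a * b) (2 * a\<^sup>2 - a * b)"
    "not_mono (a\<^sup>2 + a * b + j * b\<^sup>2 - b\<^sup>2) (a\<^sup>2 + b\<^sup>2 - a * b) (2 * a\<^sup>2 + j * a * b - 2 * a * b)"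
    "not_mono (a\<^sup>2 + 2 * a * b + j * a * b - b\<^sup>2) (a\<^sup>2 + a * b + j * a * b) (a\<^sup>2 - a * b)"
    "not_mono (a\<^sup>2 + 2 * a * b + j * b\<^sup>2) (a\<^sup>2 + j * b\<^sup>2) (2 * a\<^sup>2)"
    "not_mono (a\<^sup>2 + j * a * b - a * b) (a\<^sup>2 - b\<^sup>2) (a * b + j * a\<^sup>2 - a\<^sup>2)"
    "not_mono (a * b + j * a\<^sup>2 - a\<^sup>2) (a * b + j * a\<^sup>2 - a\<^sup>2 - j * a * b) (j * a\<^sup>2)"
    "not_mono (a\<^sup>2 + j * a * b - a * b - b\<^sup>2) (a\<^sup>2 - b\<^sup>2) (j * a\<^sup>2 - a\<^sup>2)"
    "not_mono (a\<^sup>2 + 2 * a * b + b\<^sup>2) (a\<^sup>2 + 2 * b\<^sup>2) (2 * a\<^sup>2 - a * b)"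
    "not_mono (a\<^sup>2 + 2 * a * b) (a\<^sup>2 + 2 * a * b - b\<^sup>2) (a * b)"
    "not_mono (2 * a\<^sup>2 + j * a * b - b\<^sup>2) (2 * a\<^sup>2 + j * a * b - a * b) (a\<^sup>2 - a * b)"
    "not_mono (a\<^sup>2 + b\<^sup>2 + j * a * b - a * b) (a\<^sup>2 + j * a * b - a * b) (a * b)"
    "not_mono (2 * a\<^sup>2 + j * a * b - 2 * a * b) (2 * a\<^sup>2 - 2 * a * b) (j * a\<^sup>2)"
    "not_mono (a\<^sup>2 + a * b + j * a * b) (a\<^sup>2 + a * b) (j * a\<^sup>2)"
    "not_mono (2 * a\<^sup>2 + j * a * b - b\<^sup>2) (2 * a\<^sup>2 - b\<^sup>2) (j * a\<^sup>2)"
    "not_mono (a\<^sup>2 + a * b - b\<^sup>2) (a\<^sup>2 - b\<^sup>2) (a\<^sup>2)"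
    "not_mono (a\<^sup>2 + b\<^sup>2 - a * b) (a\<^sup>2 - a * b) (a * b)"
    "not_mono (a\<^sup>2 + 2 * a * b) (a\<^sup>2 + a * b - b\<^sup>2) (a\<^sup>2 + a * b)"
    "not_mono (a\<^sup>2 + 2 * a * b + j * b\<^sup>2 - b\<^sup>2) (a\<^sup>2 + b\<^sup>2) (2 * a\<^sup>2 + j * a * b - 2 * a * b)"
    "not_mono (2 * a\<^sup>2 + j * a * b - 2 * a * b) (2 * a\<^sup>2) (j * a\<^sup>2 - 2 * a\<^sup>2)"
    "not_mono (2 * a\<^sup>2 + j * a * b - b\<^sup>2) (2 * a\<^sup>2 + a * b - b\<^sup>2) (j * a\<^sup>2 - a\<^sup>2)"
    "not_mono (a\<^sup>2 + a * b + j * a * b) (a\<^sup>2 + 2 * a * b + j * b\<^sup>2 - b\<^sup>2) (a * b + j * a\<^sup>2 - a\<^sup>2 - j * a * b)"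
    "not_mono (2 * a\<^sup>2 + a * b + b\<^sup>2) (2 * a\<^sup>2 - a * b - b\<^sup>2) (2 * a\<^sup>2 + 2 * a * b)"
    "not_mono (a\<^sup>2 + b\<^sup>2 + j * a * b - a * b) (a\<^sup>2 + b\<^sup>2 - a * b) (j * a\<^sup>2)"
    "not_mono (a\<^sup>2) (a\<^sup>2 - a * b) (a\<^sup>2)"
    "not_mono (a\<^sup>2 + a * b) (a\<^sup>2 + a * b - b\<^sup>2) (a * b)"
    "not_mono (a\<^sup>2 + a * b) (a\<^sup>2 - b\<^sup>2) (a\<^sup>2 + a * b)"
    "not_mono (a\<^sup>2 + 2 * a * b) (a\<^sup>2 + a * b + b\<^sup>2) (a\<^sup>2 - a * b)"
    "not_mono (a\<^sup>2 + j * b\<^sup>2) (a\<^sup>2 + b\<^sup>2 - a * b) (a\<^sup>2 + j * a * b - a * b)"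
    "not_mono (a * b + j * a\<^sup>2 - 2 * a\<^sup>2) (j * a\<^sup>2 - 2 * a\<^sup>2) (a\<^sup>2)"
    "not_mono (2 * a\<^sup>2 + j * a * b - a * b) (2 * a\<^sup>2) (j * a\<^sup>2 - a\<^sup>2)"
    "not_mono (a\<^sup>2 + b\<^sup>2 + j * a * b - 2 * a * b) (a\<^sup>2 + b\<^sup>2 - 2 * a * b) (j * a\<^sup>2)"
    "not_mono (a\<^sup>2 + a * b + j * a * b) (a\<^sup>2 + b\<^sup>2 + j * a * b) (a\<^sup>2 - a * b)"
    "not_mono (a\<^sup>2 + a * b - b\<^sup>2) (a\<^sup>2 - a * b) (2 * a\<^sup>2 - a * b)"
    "not_mono (a\<^sup>2 + j * a * b - 2 * b\<^sup>2) (a\<^sup>2 - b\<^sup>2) (j * a\<^sup>2 - a * b)"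
    "not_mono (a\<^sup>2 + b\<^sup>2 + j * a * b) (a\<^sup>2 + b\<^sup>2) (j * a\<^sup>2)"
    "not_mono (a\<^sup>2 + 2 * a * b + j * b\<^sup>2) (a\<^sup>2 + a * b + j * b\<^sup>2 - b\<^sup>2) (a\<^sup>2 + a * b)"
    "not_mono (a\<^sup>2 + j * a * b - a * b) (a\<^sup>2 + a * b - b\<^sup>2) (a * b + j * a\<^sup>2 - 2 * a\<^sup>2)"
    "not_mono (a\<^sup>2 + a * b + j * b\<^sup>2) (a\<^sup>2 + j * b\<^sup>2 - b\<^sup>2) (a\<^sup>2 + a * b)"
    "not_mono (2 * a\<^sup>2 + a * b + b\<^sup>2) (2 * a\<^sup>2 + a * b) (a * b)"
    "not_mono (2 * a\<^sup>2 + 2 * a * b) (2 * a\<^sup>2 - b\<^sup>2) (2 * a\<^sup>2 + a * b)"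
    "not_mono (a\<^sup>2 + a * b + b\<^sup>2) (a\<^sup>2 + b\<^sup>2) (a\<^sup>2)"
    "not_mono (a\<^sup>2 + b\<^sup>2 + j * a * b - a * b) (a\<^sup>2 + a * b) (a * b + j * a\<^sup>2 - 2 * a\<^sup>2)"
    "not_mono (2 * a\<^sup>2 + a * b + b\<^sup>2) (2 * a\<^sup>2 + b\<^sup>2) (a\<^sup>2)"
    "not_mono (a\<^sup>2 + b\<^sup>2 + j * a * b - 2 * a * b) (a\<^sup>2 + b\<^sup>2) (j * a\<^sup>2 - 2 * a\<^sup>2)"
    "not_mono (j * a\<^sup>2 - a\<^sup>2) (j * a\<^sup>2 - a\<^sup>2 - a * b) (a\<^sup>2)"
    "not_mono (2 * a\<^sup>2 + a * b) (2 * a\<^sup>2 - a * b - b\<^sup>2) (2 * a\<^sup>2 + a * b)"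
    "not_mono (2 * a\<^sup>2 + j * a * b - b\<^sup>2) (2 * a\<^sup>2) (j * a\<^sup>2 - a * b)"
    "not_mono (a\<^sup>2 + j * a * b - a * b - b\<^sup>2) (a\<^sup>2 - a * b) (j * a\<^sup>2 - a * b)"
    "not_mono (a\<^sup>2 + j * a * b - 2 * b\<^sup>2) (a\<^sup>2 + j * a * b - a * b - b\<^sup>2) (a\<^sup>2 - a * b)"
    "not_mono (a\<^sup>2 + 2 * a * b) (a\<^sup>2 + b\<^sup>2) (2 * a\<^sup>2 - a * b)"
    "not_mono (a\<^sup>2 + b\<^sup>2 + j * a * b) (a\<^sup>2 + 2 * a * b + 2 * b\<^sup>2) (j * a\<^sup>2 - 2 * a\<^sup>2 - a * b)"
    "not_mono (a\<^sup>2 + j * a * b - a * b) (a\<^sup>2 - a * b) (j * a\<^sup>2)"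
    "not_mono (a\<^sup>2 + 2 * a * b + b\<^sup>2) (a\<^sup>2 + a * b + b\<^sup>2) (a\<^sup>2)"
    "not_mono (a\<^sup>2 + 2 * a * b) (a\<^sup>2) (2 * a\<^sup>2)"
    "not_mono (a\<^sup>2 + b\<^sup>2 + j * a * b) (a\<^sup>2 + j * a * b - a * b) (a\<^sup>2 + a * b)"
    "not_mono (a\<^sup>2 + j * b\<^sup>2) (a\<^sup>2 - a * b) (a\<^sup>2 + j * a * b)"
    "not_mono (a\<^sup>2 + 2 * a * b + j * b\<^sup>2) (a\<^sup>2 + a * b + j * b\<^sup>2) (a\<^sup>2)"
    "not_mono (a\<^sup>2 + a * b + j * a * b - b\<^sup>2) (a\<^sup>2 + a * b - b\<^sup>2) (j * a\<^sup>2)"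
    "not_mono (a\<^sup>2 + b\<^sup>2 + j * a * b - 2 * a * b) (a\<^sup>2 - a * b) (a * b + j * a\<^sup>2 - a\<^sup>2)"
    "not_mono (a\<^sup>2 + j * a * b) (a\<^sup>2 + b\<^sup>2 + j * a * b - 2 * a * b) (2 * a\<^sup>2 - a * b)"
    "not_mono (a\<^sup>2 + b\<^sup>2 + j * a * b - 2 * a * b) (a\<^sup>2 + 2 * b\<^sup>2) (j * a\<^sup>2 - 2 * a\<^sup>2 - a * b)"
    "not_mono (2 * a\<^sup>2 + a * b) (2 * a\<^sup>2 + a * b - b\<^sup>2) (a * b)"
    "not_mono (a\<^sup>2 + 2 * a * b - b\<^sup>2) (a\<^sup>2 + a * b) (a\<^sup>2 - a * b)"
    "not_mono (a\<^sup>2 + a * b - b\<^sup>2) (a\<^sup>2 + b\<^sup>2 - a * b) (2 * a\<^sup>2 - 2 * a * b)"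
    "not_mono (a\<^sup>2 + b\<^sup>2 + j * a * b) (a\<^sup>2 + 2 * a * b + b\<^sup>2) (j * a\<^sup>2 - 2 * a\<^sup>2)"
    "not_mono (a\<^sup>2 + a * b + j * b\<^sup>2 - b\<^sup>2) (a\<^sup>2 - b\<^sup>2) (a\<^sup>2 + j * a * b)"
    "not_mono (a\<^sup>2 + 2 * a * b + b\<^sup>2) (a\<^sup>2 + a * b - b\<^sup>2) (a\<^sup>2 + 2 * a * b)"
    "not_mono (a\<^sup>2 + 2 * a * b + j * b\<^sup>2) (a\<^sup>2 + a * b) (a\<^sup>2 + j * a * b)"
    "not_mono (a\<^sup>2 + j * b\<^sup>2) (a\<^sup>2 + j * b\<^sup>2 - b\<^sup>2) (a * b)"
    "not_mono (a\<^sup>2 + b\<^sup>2) (a\<^sup>2) (a * b)"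
    by ((rule not_monoI, (fact pts)+, algebra)+)
  show False
    using init pts[THEN cover] sols
    unfolding not_mono_def by sat
qed

section \<open>Upper bounds\<close>

lemma not_mono_free_generalized_schur:
  fixes t :: int
  assumes t: "t \<ge> 1"
  shows "\<not> mono_free 1 t (t ^ 3 + 5 * t\<^sup>2 + 7 * t + 1) c"
proof
  assume free: "mono_free 1 t (t ^ 3 + 5 * t\<^sup>2 + 7 * t + 1) c" (is "mono_free 1 t ?N c")
  have "t\<^sup>2 \<ge> 0" "t ^ 3 \<ge> 0"
    using t by simp_all
  then have pts: "t + 1 \<in> {1..?N}" "t\<^sup>2 + 2 * t + 1 \<in> {1..?N}"
    using t by auto
  \<comment> \<open>The solution with \<open>y = z = t + 1\<close> and
    \<open>x = (t + 1) ^ 2\<close> separates the two points whose colours become \<open>r\<close>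
    and \<open>g\<close>.\<close>
  have "1 * (t\<^sup>2 + 2 * t + 1 - (t + 1)) = t * (t + 1)"
    by algebra
  then have "c (t + 1) \<noteq> c (t\<^sup>2 + 2 * t + 1)"
    using mono_freeD[OF free pts(2,1,1)] by auto
  then obtain s where "three_coloring 1 t ?N c (c (t + 1)) (c (t\<^sup>2 + 2 * t + 1)) s"
    using three_coloring_of_mono_free[OF free pts] by blast
  then show False
    using three_coloring_generalized_schur t by blast
qed

lemma not_mono_free_pred:
  fixes a :: int
  assumes a: "a \<ge> 3"
  shows "\<not> mono_free a (a - 1) (a ^ 3 + (a - 1)\<^sup>2) c"
proof
  assume free: "mono_free a (a - 1) (a ^ 3 + (a - 1)\<^sup>2) c" (is "mono_free a _ ?N c")
  have "a\<^sup>2 \<ge> 3 * a" "a ^ 3 \<ge> 3 * a\<^sup>2"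
    using a by (simp_all add: power2_eq_square power3_eq_cube mult_right_mono)
  moreover have "?N \<ge> a ^ 3"
    by simp
  ultimately have "1 \<le> a\<^sup>2" "a\<^sup>2 \<le> ?N" "1 \<le> a" "a \<le> ?N"
    using a by linarith+
  then have pts: "a\<^sup>2 \<in> {1..?N}" "a \<in> {1..?N}"
    by simp_all
  \<comment> \<open>The solution with \<open>x = z = a ^ 2\<close> and \<open>y = a\<close>
    separates the two named points.\<close>
  have "a * (a\<^sup>2 - a) = (a - 1) * a\<^sup>2"
    by algebra
  then have "c (a\<^sup>2) \<noteq> c a"
    using mono_freeD[OF free pts(1,2,1)] by auto
  then obtain s where "three_coloring a (a - 1) ?N c (c (a\<^sup>2)) (c a) s"
    using three_coloring_of_mono_free[OF free pts] by blast
  then show False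
    using three_coloring_pred a by blast
qed

lemma not_mono_free_cube:
  fixes a b :: int
  assumes b: "b \<ge> 1" "a \<ge> b + 2"
  shows "\<not> mono_free a b (a ^ 3) c"
proof
  assume free: "mono_free a b (a ^ 3) c"
  have mult: "j * a\<^sup>2 \<in> {1..a ^ 3}" if "1 \<le> j" "j \<le> a" for j
  proof -
    have "1 * a\<^sup>2 \<le> j * a\<^sup>2" "j * a\<^sup>2 \<le> a * a\<^sup>2"
      using that by (auto intro: mult_right_mono)
    moreover have "1 \<le> a\<^sup>2"
      using b by (simp add: int_one_le_iff_zero_less)
    moreover have "a * a\<^sup>2 = a ^ 3"
      by (simp add: power2_eq_square power3_eq_cube)
    ultimately show ?thesis
      by simp
  qed
  have const: "c (j * a\<^sup>2) = c (a\<^sup>2)" if "1 \<le> j" "j \<le> a" for j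
    using that
  \<comment> \<open>Complete induction is needed because the step looks back to
    \<open>j - 1\<close>, \<open>j - 2\<close> and 2; the measure \<open>nat j\<close> makes it
    available for integers.\<close>
  proof (induction "nat j" arbitrary: j rule: less_induct)
    case less
    show ?case
    proof (rule ccontr)
      assume "c (j * a\<^sup>2) \<noteq> c (a\<^sup>2)"
      then have ne: "c (a\<^sup>2) \<noteq> c (j * a\<^sup>2)"
        by simp
      have "a\<^sup>2 \<in> {1..a ^ 3}"
        using mult[of 1] b by simp
      then obtain s where s: "three_coloring a b (a ^ 3) c (c (a\<^sup>2)) (c (j * a\<^sup>2)) s"
        using three_coloring_of_mono_free[OF free _ mult[OF less.prems] ne] by blast
      have "j \<noteq> 1"
        using ne by auto
      moreover have "j \<noteq> 2"
        using three_coloring_double[OF s b] by auto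
      ultimately have j: "j \<ge> 3"
        using less.prems by linarith
      \<comment> \<open>At \<open>j = 3\<close> these multiples are just \<open>a ^ 2\<close> and
        \<open>2 * a ^ 2\<close>, so the step already applies right after
        \<open>j = 2\<close>.\<close>
      then have "c (2 * a\<^sup>2) = c (a\<^sup>2)" "c ((j - 1) * a\<^sup>2) = c (a\<^sup>2)" "c ((j - 2) * a\<^sup>2) = c (a\<^sup>2)"
        using less.hyps[of 2] less.hyps[of "j - 1"] less.hyps[of "j - 2"] less.prems by auto
      then show False
        using three_coloring_step[OF s b j less.prems(2)] by (simp add: left_diff_distrib)
    qed
  qed
  have "c ((a - b) * a\<^sup>2) = c (a * a\<^sup>2)"
    using const[of "a - b"] const[of a] b by simp
  moreover have "a * (a * a\<^sup>2 - (a - b) * a\<^sup>2) = b * (a * a\<^sup>2)"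
    by algebra
  moreover have "a * a\<^sup>2 \<in> {1..a ^ 3}" "(a - b) * a\<^sup>2 \<in> {1..a ^ 3}"
    using mult[of a] mult[of "a - b"] b by auto
  ultimately show False
    using mono_freeD[OF free] by metis
qed

section \<open>Exact values for the three families of equations\<close>

theorem theorem1:
  shows "(\<forall>m::int. m \<ge> 3 \<longrightarrow>
            rado_number 3 (diff_eq 1 (m - 2)) = enat (nat (m ^ 3 - m ^ 2 - m - 1)))
       \<and> (\<forall>a::int. a \<ge> 3 \<longrightarrow>
            rado_number 3 (diff_eq a (a - 1)) = enat (nat (a ^ 3 + (a - 1) ^ 2)))
       \<and> (\<forall>a b::int. b \<ge> 1 \<and> a \<ge> b + 2 \<and> gcd a b = 1 \<longrightarrow>
            rado_number 3 (diff_eq a b) = enat (nat (a ^ 3)))"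
proof (intro conjI allI impI)
  fix m :: int
  assume "m \<ge> 3"
  \<comment> \<open>In terms of \<open>t = m - 2\<close> the claimed value has only positive
    coefficients, which keeps the block lengths and the interval bounds simple.\<close>
  define t where "t = m - 2"
  have t: "t \<ge> 1"
    using \<open>m \<ge> 3\<close> by (simp add: t_def)
  let ?N = "t ^ 3 + 5 * t\<^sup>2 + 7 * t + 1"
  have "rado_number 3 (diff_eq 1 t) = enat (nat ?N)"
  proof (rule rado_number_eqI)
    show "?N \<ge> 1"
      using t by simp
    show "\<not> mono_free 1 t ?N c" for c
      by (rule not_mono_free_generalized_schur[OF t])
  qed (unfold add_diff_cancel_right', rule mono_free_generalized_schur[OF t])
  moreover have "?N = m ^ 3 - m ^ 2 - m - 1"
    unfolding t_def by algebra
  ultimately show "rado_number 3 (diff_eq 1 (m - 2)) = enat (nat (m ^ 3 - m ^ 2 - m - 1))"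
    by (simp add: t_def)
next
  fix a :: int
  assume a: "a \<ge> 3"
  show "rado_number 3 (diff_eq a (a - 1)) = enat (nat (a ^ 3 + (a - 1) ^ 2))"
  proof (rule rado_number_eqI)
    show "a ^ 3 + (a - 1) ^ 2 \<ge> 1"
      using a one_le_power[of a 3] zero_le_power2[of "a - 1"] by linarith
  qed (rule not_mono_free_pred[OF a] mono_free_pred[OF a])+
next
  fix a b :: int
  assume ab: "b \<ge> 1 \<and> a \<ge> b + 2 \<and> gcd a b = 1"
  then have "coprime a b" and a: "a \<ge> 2"
    by (simp_all add: coprime_iff_gcd_eq_1)
  show "rado_number 3 (diff_eq a b) = enat (nat (a ^ 3))"
  proof (rule rado_number_eqI)
    show "a ^ 3 \<ge> 1"
      using a by simp
    show "\<not> mono_free a b (a ^ 3) c" for c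
      using ab by (intro not_mono_free_cube) auto
  qed (rule mono_free_valuation[OF a \<open>coprime a b\<close>])
qed

end
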